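(* Let $(\mathsf{X},\mathcal{A},\pi)$ be a probability space, let $(\mathsf{Y},\mathcal{B})$, $(\mathsf{Z},\mathcal{C})$ be measurable spaces, and let $\tilde\pi$ be a probability measure on $\mathcal{B}\times\mathcal{C}$ with $\tilde\pi(\mathrm{d}(y,z))=\varpi_z(\mathrm{d}y)\,\varpi(\mathrm{d}z)$, where $\varpi$ is the marginal of $\tilde\pi$ on $\mathsf{Z}$. Let $S$ be a Markov transition kernel on $\mathsf{X}$ reversible with respect to $\pi$. Assume: (1) as an operator on $L_0^2(\pi)$, $S=P^*QP$, where $P:L_0^2(\pi)\to L_0^2(\tilde\pi)$ is a linear transformation and $Q$ is (the operator on $L_0^2(\tilde\pi)$ of) a Markov transition kernel on $\mathsf{Y}\times\mathsf{Z}$ reversible with respect to $\tilde\pi$; (2) $\|Pf\|_{\tilde\pi}\le\|f\|_\pi$ and $\|Pf\|_{\mathrm{osc}}\le\|f\|_{\mathrm{osc}}$ for all $f\in L_0^2(\pi)$; (3) $\{Q_z\}_{z\in\mathsf{Z}}$ are Markov transition kernels on $\mathsf{Y}$ such that $Q_z$ is reversible with respect to $\varpi_z$ for $\varpi$-a.e. $z$, and $(y,z)\mapsto Q_z(y,\mathsf{B})$ is measurable for each $\mathsf{B}\in\mathcal{B}$; (4) there is a constant $c_0\in(0,1]$ such that, for $\tilde\pi$-a.e. $(y,z)\in\mathsf{Y}\times\mathsf{Z}$ and every $\mathsf{B}\in\mathcal{B}$, $Q((y,z),(\mathsf{B}\setminus\{y\})\times\{z\})\ge c_0\,Q_z(y,\mathsf{B}\setminus\{y\})$;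 (5) there is a measurable function $\alpha:\mathsf{Z}\times(0,\infty)\to[0,\infty)$ such that, for $\varpi$-a.e. $z\in\mathsf{Z}$, all $u>0$, and all $g\in L_0^2(\varpi_z)$, $\|g\|_{\varpi_z}^2\le u\,\mathcal{E}_{Q_z}(g)+\alpha(z,u)\,\|g\|_{\mathrm{osc}}^2$; (6) there is a non-increasing function $\beta:(0,\infty)\to[0,\infty)$ with $\beta(u)\downarrow0$ as $u\to\infty$ such that, for all $f\in L_0^2(\pi)$ and $u>0$, $\|f\|_\pi^2\le u\,\mathcal{E}_{P^*E^*EP}(f)+\beta(u)\,\|f\|_{\mathrm{osc}}^2$. Let $\bar\alpha(u)=\int_{\mathsf{Z}}\alpha(z,u)\,\varpi(\mathrm{d}z)$. Then, for all $f\in L_0^2(\pi)$ and $u>0$, $$\|f\|_\pi^2\le u\,\mathcal{E}_S(f)+\tilde\beta(u)\,\|f\|_{\mathrm{osc}}^2,$$ where $\tilde\beta(u)=\max\{1/4,\ \beta(c_0)+\bar\alpha(1)\}$ when $u<1$, and $\tilde\beta(u)=\inf\{\beta(u_1)+u_1\,\bar\alpha(u_2):\ u_1u_2=c_0u,\ u_1>0,\ u_2>1\}$ when $u\ge1$. Furthermore, if $\bar\alpha(u)$ is a non-increasing function of $u$ such that $\bar\alpha(u)\downarrow0$ as $u\to\infty$, then so is $\tilde\beta(u)$.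
   Context: For a probability measure $\rho$, $L_0^2(\rho)$ is the Hilbert space of real square-integrable functions with $\rho$-mean zero, with inner product $\langle\cdot,\cdot\rangle_\rho$ and norm $\|\cdot\|_\rho$. For a function $f$ on a probability space with measure $\rho$, $\|f\|_{\mathrm{osc}}=\operatorname{ess\,sup}f-\operatorname{ess\,inf}f$ (with respect to $\rho$; possibly $+\infty$); the reference measure is $\pi$ for $f\in L_0^2(\pi)$, $\tilde\pi$ for $Pf$, and $\varpi_z$ for $g\in L_0^2(\varpi_z)$. A Markov transition kernel $K$ with $\rho K=\rho$ acts on $L_0^2(\rho)$ by $Kf(w)=\int K(w,\mathrm{d}w')f(w')$; it is reversible iff this operator is self-adjoint. For self-adjoint $J$ on $L_0^2(\rho)$ with norm at most $1$: $\mathcal{E}_J(f)=\|f\|_\rho^2-\langle f,Jf\rangle_\rho$. $P^*$ is the Hilbert-space adjoint of $P$. $E:L_0^2(\tilde\pi)\to L_0^2(\varpi)$ is $Eh(z)=\int_{\mathsf{Y}}h(y,z)\,\varpi_z(\mathrm{d}y)$, with adjoint $E^*g(y,z)=g(z)$. Singletons of $\mathsf{Y}$ and $\mathsf{Z}$ are understood to be measurable, so that (4) makes sense.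
   Formalization: The claim that β̃ is non-increasing can fail at u=1 if β jumps at c₀; it is proved on (0,∞) without the point 1 and on [1,∞), and on all of (0,∞) when β is left-continuous at c₀. *)

theory Defs
  imports "HOL-Probability.Probability"
begin

text \<open>
  Elements of $L_0^2(\rho)$ are represented by square-integrable functions rather than by their
  a.e. equivalence classes; operators are therefore required to respect a.e. equality, and
  identities between operators hold a.e.
\<close>

definition L02 :: "'a measure \<Rightarrow> ('a \<Rightarrow> real) set" where
  "L02 \<rho> = {f \<in> borel_measurable \<rho>. integrable \<rho> (\<lambda>x. (f x)\<^sup>2) \<and> (\<integral>x. f x \<partial>\<rho>) = 0}"

definition L2_inner :: "'a measure \<Rightarrow> ('a \<Rightarrow> real) \<Rightarrow> ('a \<Rightarrow> real) \<Rightarrow> real" where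
  "L2_inner \<rho> f g = (\<integral>x. f x * g x \<partial>\<rho>)"

definition L2_norm :: "'a measure \<Rightarrow> ('a \<Rightarrow> real) \<Rightarrow> real" where
  "L2_norm \<rho> f = sqrt (L2_inner \<rho> f f)"

definition L02_linear ::
  "'a measure \<Rightarrow> 'b measure \<Rightarrow> (('a \<Rightarrow> real) \<Rightarrow> 'b \<Rightarrow> real) \<Rightarrow> bool" where
  "L02_linear \<rho> \<sigma> T \<longleftrightarrow>
     (\<forall>f\<in>L02 \<rho>. T f \<in> L02 \<sigma>) \<and>
     (\<forall>f\<in>L02 \<rho>. \<forall>g\<in>L02 \<rho>. (AE x in \<rho>. f x = g x) \<longrightarrow> (AE y in \<sigma>. T f y = T g y)) \<and>
     (\<forall>f\<in>L02 \<rho>. \<forall>g\<in>L02 \<rho>. AE y in \<sigma>. T (\<lambda>x. f x + g x) y = T f y + T g y) \<and>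
     (\<forall>f\<in>L02 \<rho>. \<forall>c. AE y in \<sigma>. T (\<lambda>x. c * f x) y = c * T f y)"

text \<open>The Hilbert-space adjoint; for bounded \<open>T\<close> it exists and is unique up to a.e. equality.\<close>

definition L02_adjoint ::
  "'a measure \<Rightarrow> 'b measure \<Rightarrow> (('a \<Rightarrow> real) \<Rightarrow> 'b \<Rightarrow> real) \<Rightarrow> ('b \<Rightarrow> real) \<Rightarrow> 'a \<Rightarrow> real" where
  "L02_adjoint \<rho> \<sigma> T =
     (SOME U. L02_linear \<sigma> \<rho> U \<and>
        (\<forall>f\<in>L02 \<rho>. \<forall>h\<in>L02 \<sigma>. L2_inner \<sigma> (T f) h = L2_inner \<rho> f (U h)))"

definition dirichlet_form ::
  "'a measure \<Rightarrow> (('a \<Rightarrow> real) \<Rightarrow> 'a \<Rightarrow> real) \<Rightarrow> ('a \<Rightarrow> real) \<Rightarrow> real" where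
  "dirichlet_form \<rho> J f = (L2_norm \<rho> f)\<^sup>2 - L2_inner \<rho> f (J f)"

definition kernel_op :: "('a \<Rightarrow> 'b measure) \<Rightarrow> ('b \<Rightarrow> real) \<Rightarrow> 'a \<Rightarrow> real" where
  "kernel_op K f = (\<lambda>x. \<integral>y. f y \<partial>K x)"

definition reversible_kernel :: "'a measure \<Rightarrow> ('a \<Rightarrow> 'a measure) \<Rightarrow> bool" where
  "reversible_kernel \<rho> K \<longleftrightarrow>
     K \<in> \<rho> \<rightarrow>\<^sub>M prob_algebra \<rho> \<and> \<rho> \<bind> K = \<rho> \<and>
     (\<forall>f\<in>L02 \<rho>. \<forall>g\<in>L02 \<rho>. L2_inner \<rho> (kernel_op K f) g = L2_inner \<rho> f (kernel_op K g))"

definition essinf :: "'a measure \<Rightarrow> ('a \<Rightarrow> ereal) \<Rightarrow> ereal" where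
  "essinf \<rho> f = - esssup \<rho> (\<lambda>x. - f x)"

definition osc_norm :: "'a measure \<Rightarrow> ('a \<Rightarrow> real) \<Rightarrow> ereal" where
  "osc_norm \<rho> f = esssup \<rho> (\<lambda>x. ereal (f x)) - essinf \<rho> (\<lambda>x. ereal (f x))"

text \<open>\<open>fiber_avg \<kappa>\<close> is the operator $E$ and \<open>fiber_lift\<close> its adjoint $E^*$.\<close>

definition fiber_avg :: "('z \<Rightarrow> 'y measure) \<Rightarrow> ('y \<times> 'z \<Rightarrow> real) \<Rightarrow> 'z \<Rightarrow> real" where
  "fiber_avg \<kappa> h = (\<lambda>z. \<integral>y. h (y, z) \<partial>\<kappa> z)"

definition fiber_lift :: "('z \<Rightarrow> real) \<Rightarrow> 'y \<times> 'z \<Rightarrow> real" where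
  "fiber_lift g = (\<lambda>(y, z). g z)"

definition alpha_bar :: "'z measure \<Rightarrow> ('z \<Rightarrow> real \<Rightarrow> real) \<Rightarrow> real \<Rightarrow> ereal" where
  "alpha_bar \<omega> \<alpha> u = enn2ereal (\<integral>\<^sup>+ z. ennreal (\<alpha> z u) \<partial>\<omega>)"

definition beta_tilde :: "real \<Rightarrow> (real \<Rightarrow> real) \<Rightarrow> (real \<Rightarrow> ereal) \<Rightarrow> real \<Rightarrow> ereal" where
  "beta_tilde c\<^sub>0 \<beta> ab u =
     (if u < 1 then max (ereal (1/4)) (ereal (\<beta> c\<^sub>0) + ab 1)
      else Inf {ereal (\<beta> u\<^sub>1) + ereal u\<^sub>1 * ab u\<^sub>2 | u\<^sub>1 u\<^sub>2. u\<^sub>1 * u\<^sub>2 = c\<^sub>0 * u \<and> u\<^sub>1 > 0 \<and> u\<^sub>2 > 1})"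

text \<open>
  At \<open>u = 1\<close> the constraint \<open>u\<^sub>2 > 1\<close> forces \<open>u\<^sub>1 < c\<^sub>0\<close>. If \<open>\<beta>\<close> jumps at \<open>c\<^sub>0\<close>, the value at
  \<open>1\<close> can therefore exceed the (constant) value on \<open>(0, 1)\<close>, as the following example shows.
\<close>

lemma beta_tilde_jump_at_one:
  fixes \<beta> :: "real \<Rightarrow> real"
  assumes \<beta>: "\<And>u. \<beta> u = (if u < 1 then 1 else 0)"
  shows "beta_tilde 1 \<beta> (\<lambda>_. 0) (1/2) = ereal (1/4)" "beta_tilde 1 \<beta> (\<lambda>_. 0) 1 \<ge> 1"
proof -
  show "beta_tilde 1 \<beta> (\<lambda>_. 0) (1/2) = ereal (1/4)"
    by (simp add: beta_tilde_def \<beta> max_def)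
  have "1 \<le> ereal (\<beta> u\<^sub>1)" if *: "u\<^sub>1 * u\<^sub>2 = 1" "0 < u\<^sub>1" "1 < u\<^sub>2" for u\<^sub>1 u\<^sub>2
  proof -
    have "u\<^sub>1 * 1 < u\<^sub>1 * u\<^sub>2" using * by (intro mult_strict_left_mono) auto
    then show ?thesis using * by (simp add: \<beta>)
  qed
  then show "beta_tilde 1 \<beta> (\<lambda>_. 0) 1 \<ge> 1"
    unfolding beta_tilde_def by (auto intro!: Inf_greatest)
qed

end

theory Submission
  imports Defs
begin

text \<open>
  Disintegrating \<open>\<pi>t\<close> splits the variance of \<open>h = P f\<close> into the variance of \<open>fiber_avg \<kappa> h\<close> and
  the mean of the variances on the fibers. The latter are bounded by the weak Poincare inequalities
  of the kernels \<open>Qz z\<close>, and, writing Dirichlet forms as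
  $\frac12\int\int (h(w)-h(w'))^2\,Q(w,\mathrm{d}w')\,\tilde\pi(\mathrm{d}w)$, the moves of \<open>Q\<close> inside a
  fiber show that the averaged Dirichlet forms of the \<open>Qz z\<close> are at most $1/c_0$ times that of \<open>Q\<close>.
  The defect $\|f\|^2-\|Pf\|^2\ge 0$ is absorbed because $u_2/c_0\ge 1$, so that
  $\mathcal{E}_{P^*E^*EP}(f)\le (u_2/c_0)\,\mathcal{E}_S(f)+\bar\alpha(u_2)\|f\|_{\mathrm{osc}}^2$;
  this is inserted into the inequality for $P^*E^*EP$ at $u_1$. For $u<1$ the variance bound
  $\|f\|^2\le\|f\|_{\mathrm{osc}}^2/4$ suffices.
\<close>

subsection \<open>Square-integrable functions and Markov kernels\<close>

text \<open>The hypothesis \<open>Q_ge\<close> gives no information about the mass that stays at the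
  current point, so the comparison is made on Dirichlet forms written as double integrals of squared
  differences: the integrand vanishes on the diagonal and only the controlled mass contributes.
  Infinite values are the second obstacle. The oscillation and \<open>alpha_bar\<close> live in
  \<open>ereal\<close>, where 0 * \<infinity> = 0. Fiber estimates therefore use nonnegative
  integrals. The inequality is obtained for a real oscillation \<open>D\<close> and one admissible
  pair at a time; the infimum is reached by dividing by the square of \<open>D\<close>, and an
  infinite oscillation is reduced to finite ones by truncation. \<open>L02_adjoint\<close> is a
  choice operator, so its defining property rests on an existence proof, which is what the Riesz
  representation on functions (not on classes) supplies. The constraint \<open>u\<^sub>2 > 1\<close>
  excludes the pair of \<open>c\<^sub>0\<close> and 1 at u = 1. This is why monotonicity across 1 is
  obtained only when \<beta> is left continuous at \<open>c\<^sub>0\<close>.\<close>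

lemma integral_bind_kernel_nonneg:
  fixes f :: "'b \<Rightarrow> real"
  assumes K[measurable]: "K \<in> M \<rightarrow>\<^sub>M subprob_algebra N" and M: "space M \<noteq> {}"
    and f: "integrable (M \<bind> K) f" and nonneg: "\<And>x. 0 \<le> f x"
  shows "AE x in M. integrable (K x) f"
    and "integrable M (\<lambda>x. \<integral>y. f y \<partial>K x)"
    and "(\<integral>x. f x \<partial>(M \<bind> K)) = (\<integral>x. \<integral>y. f y \<partial>K x \<partial>M)"
proof -
  have [measurable]: "f \<in> borel_measurable N"
    using borel_measurable_integrable[OF f] sets_bind[OF sets_kernel[OF K] M]
    by (simp cong: measurable_cong_sets)
  have Kf: "(\<lambda>x. \<integral>\<^sup>+y. f y \<partial>K x) \<in> borel_measurable M"
    by (rule measurable_compose[OF K nn_integral_measurable_subprob_algebra]) simp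
  have eq: "(\<integral>\<^sup>+x. f x \<partial>(M \<bind> K)) = (\<integral>\<^sup>+x. \<integral>\<^sup>+y. f y \<partial>K x \<partial>M)"
    by (rule nn_integral_bind[OF _ K]) simp
  moreover have "(\<integral>\<^sup>+x. f x \<partial>(M \<bind> K)) < \<infinity>"
    using integrableD(2)[OF f] nonneg by (simp add: less_top[symmetric])
  ultimately have fin: "(\<integral>\<^sup>+x. \<integral>\<^sup>+y. f y \<partial>K x \<partial>M) < \<infinity>"
    by simp
  then have "AE x in M. (\<integral>\<^sup>+y. f y \<partial>K x) \<noteq> \<infinity>"
    by (intro nn_integral_PInf_AE[OF Kf]) auto
  then show AE: "AE x in M. integrable (K x) f"
    using AE_space
  proof eventually_elim
    case (elim x)
    then show ?case
      using nonneg sets_kernel[OF K]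
      by (intro integrableI_nonneg) (auto simp: less_top cong: measurable_cong_sets)
  qed
  have AE_eq: "AE x in M. (\<integral>\<^sup>+y. f y \<partial>K x) = ennreal (\<integral>y. f y \<partial>K x)"
    using AE by eventually_elim (simp add: nn_integral_eq_integral nonneg)
  have m: "(\<lambda>x. \<integral>y. f y \<partial>K x) \<in> borel_measurable M"
    by (rule measurable_compose[OF K integral_measurable_subprob_algebra]) simp
  have eq2: "(\<integral>\<^sup>+x. \<integral>\<^sup>+y. f y \<partial>K x \<partial>M) = (\<integral>\<^sup>+x. ennreal (\<integral>y. f y \<partial>K x) \<partial>M)"
    by (rule nn_integral_cong_AE[OF AE_eq])
  show int: "integrable M (\<lambda>x. \<integral>y. f y \<partial>K x)"
    using fin eq2 m nonneg by (intro integrableI_nonneg) (auto simp: integral_nonneg)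
  show "(\<integral>x. f x \<partial>(M \<bind> K)) = (\<integral>x. \<integral>y. f y \<partial>K x \<partial>M)"
    using f int nonneg m eq eq2 by (simp add: integral_eq_nn_integral integral_nonneg)
qed

text \<open>Fubini for kernels, from the nonnegative case applied to the positive and negative
  parts. On a null set of \<open>x\<close> the function may fail to be integrable under
  \<open>K x\<close>; there the inner integral has its default value, so the splitting of the inner
  integral is only claimed almost everywhere.\<close>

lemma integral_bind_kernel:
  fixes f :: "'b \<Rightarrow> real"
  assumes K: "K \<in> M \<rightarrow>\<^sub>M subprob_algebra N" and M: "space M \<noteq> {}"
    and f: "integrable (M \<bind> K) f"
  shows "AE x in M. integrable (K x) f"
    and "integrable M (\<lambda>x. \<integral>y. f y \<partial>K x)"
    and "(\<integral>x. f x \<partial>(M \<bind> K)) = (\<integral>x. \<integral>y. f y \<partial>K x \<partial>M)"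
proof -
  let ?p = "\<lambda>x. max (f x) 0" and ?n = "\<lambda>x. max (- f x) 0"
  have p: "integrable (M \<bind> K) ?p" and n: "integrable (M \<bind> K) ?n"
    using f by auto
  note P = integral_bind_kernel_nonneg[OF K M p] and N = integral_bind_kernel_nonneg[OF K M n]
  have f_eq: "f = (\<lambda>x. ?p x - ?n x)"
    by (auto simp: max_def)
  have AE: "AE x in M. integrable (K x) f \<and> (\<integral>y. f y \<partial>K x) = (\<integral>y. ?p y \<partial>K x) - (\<integral>y. ?n y \<partial>K x)"
    using P(1)[OF max.cobounded2] N(1)[OF max.cobounded2]
    by eventually_elim (subst f_eq, subst (2) f_eq, simp)
  then show "AE x in M. integrable (K x) f"
    by auto
  have [measurable]: "f \<in> borel_measurable N"
    using borel_measurable_integrable[OF f] sets_bind[OF sets_kernel[OF K] M]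
    by (simp cong: measurable_cong_sets)
  have m: "(\<lambda>x. \<integral>y. f y \<partial>K x) \<in> borel_measurable M"
    by (rule measurable_compose[OF K integral_measurable_subprob_algebra]) simp
  have int: "integrable M (\<lambda>x. (\<integral>y. ?p y \<partial>K x) - (\<integral>y. ?n y \<partial>K x))"
    using P(2) N(2) by simp
  show "integrable M (\<lambda>x. \<integral>y. f y \<partial>K x)"
    by (rule integrable_cong_AE_imp[OF int m]) (use AE in auto)
  have "(\<integral>x. \<integral>y. f y \<partial>K x \<partial>M) = (\<integral>x. (\<integral>y. ?p y \<partial>K x) - (\<integral>y. ?n y \<partial>K x) \<partial>M)"
    using m AE int by (intro integral_cong_AE) auto
  also have "\<dots> = (\<integral>x. ?p x \<partial>(M \<bind> K)) - (\<integral>x. ?n x \<partial>(M \<bind> K))"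
    using P(2,3) N(2,3) by simp
  also have "\<dots> = (\<integral>x. f x \<partial>(M \<bind> K))"
    by (subst (3) f_eq) (simp add: p n)
  finally show "(\<integral>x. f x \<partial>(M \<bind> K)) = (\<integral>x. \<integral>y. f y \<partial>K x \<partial>M)" ..
qed

text \<open>This is \<open>L02\<close> without the mean-zero condition: sections of a centered
  function over a fiber, truncations and constants are square integrable but in general not
  centered.\<close>

definition square_integrable :: "'a measure \<Rightarrow> ('a \<Rightarrow> real) \<Rightarrow> bool" where
  "square_integrable M f \<longleftrightarrow> f \<in> borel_measurable M \<and> integrable M (\<lambda>x. (f x)\<^sup>2)"

lemma square_integrable_measurable: "square_integrable M f \<Longrightarrow> f \<in> borel_measurable M"
  by (simp add: square_integrable_def)

lemma square_integrable_integrable_square: "square_integrable M f \<Longrightarrow> integrable M (\<lambda>x. (f x)\<^sup>2)"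
  by (simp add: square_integrable_def)

lemma L02_iff: "f \<in> L02 M \<longleftrightarrow> square_integrable M f \<and> (\<integral>x. f x \<partial>M) = 0"
  by (auto simp: L02_def square_integrable_def)

lemma square_integrable_mult:
  assumes "square_integrable M f" "square_integrable M g"
  shows "integrable M (\<lambda>x. f x * g x)"
proof (rule Bochner_Integration.integrable_bound)
  show "integrable M (\<lambda>x. (f x)\<^sup>2 + (g x)\<^sup>2)"
    using assms by (auto simp: square_integrable_def)
  show "AE x in M. norm (f x * g x) \<le> norm ((f x)\<^sup>2 + (g x)\<^sup>2)"
  proof (intro AE_I2)
    fix x
    have "0 \<le> (\<bar>f x\<bar> - \<bar>g x\<bar>)\<^sup>2 + (f x)\<^sup>2 + (g x)\<^sup>2"
      by simp
    then show "norm (f x * g x) \<le> norm ((f x)\<^sup>2 + (g x)\<^sup>2)"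
      by (simp add: power2_diff abs_mult)
  qed
qed (use assms in \<open>auto simp: square_integrable_def\<close>)

lemma square_integrable_add:
  assumes "square_integrable M f" "square_integrable M g"
  shows "square_integrable M (\<lambda>x. f x + g x)"
  using assms square_integrable_mult[OF assms]
  by (auto simp: square_integrable_def power2_sum mult.assoc)

lemma square_integrable_cmult:
  assumes "square_integrable M f"
  shows "square_integrable M (\<lambda>x. c * f x)"
  using assms by (auto simp: square_integrable_def power_mult_distrib)

lemma square_integrable_diff:
  assumes "square_integrable M f" "square_integrable M g"
  shows "square_integrable M (\<lambda>x. f x - g x)"
  using square_integrable_add[OF assms(1) square_integrable_cmult[OF assms(2), of "-1"]] by simp

lemma (in finite_measure) square_integrable_const: "square_integrable M (\<lambda>_. c)"
  by (simp add: square_integrable_def)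

lemma (in finite_measure) square_integrable_integrable:
  "square_integrable M f \<Longrightarrow> integrable M f"
  unfolding square_integrable_def by (rule square_integrable_imp_integrable) simp_all

lemma square_integrable_cong_AE:
  assumes "square_integrable M f" "g \<in> borel_measurable M" "AE x in M. f x = g x"
  shows "square_integrable M g"
  using assms unfolding square_integrable_def
  by (auto intro!: integrable_cong_AE_imp[where g="\<lambda>x. (f x)\<^sup>2"])

lemma square_integrable_cong:
  assumes "square_integrable M f" and eq: "\<And>x. x \<in> space M \<Longrightarrow> g x = f x"
  shows "square_integrable M g"
proof (rule square_integrable_cong_AE[OF assms(1)])
  show "g \<in> borel_measurable M"
    using square_integrable_measurable[OF assms(1)] measurable_cong[of M g f, OF eq] by simp
qed (simp add: eq)

lemma square_integrable_bound:
  assumes "square_integrable M f" "g \<in> borel_measurable M" "AE x in M. \<bar>g x\<bar> \<le> \<bar>f x\<bar>"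
  shows "square_integrable M g"
  using assms unfolding square_integrable_def
  by (auto simp: abs_le_square_iff intro!: Bochner_Integration.integrable_bound[where f="\<lambda>x. (f x)\<^sup>2"])

lemma (in prob_space) square_integral_ge:
  assumes "square_integrable M f"
  shows "(\<integral>x. f x \<partial>M)\<^sup>2 \<le> (\<integral>x. (f x)\<^sup>2 \<partial>M)"
proof -
  have "variance f = expectation (\<lambda>x. (f x)\<^sup>2) - (expectation f)\<^sup>2"
    using assms square_integrable_integrable[OF assms]
    by (intro variance_eq) (auto simp: square_integrable_def)
  with variance_positive[of f] show ?thesis
    by linarith
qed

lemma L2_norm_square: "(L2_norm M f)\<^sup>2 = (\<integral>x. (f x)\<^sup>2 \<partial>M)"
  by (simp add: L2_norm_def L2_inner_def power2_eq_square[symmetric])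

text \<open>The hypothesis lives on \<open>M \<bind> K\<close>, so that the same facts serve an
  invariant kernel, where this measure is \<open>M\<close> again, and the disintegration, where it
  is the joint measure and \<open>M\<close> the marginal.\<close>

lemma
  assumes M: "prob_space M" and K: "K \<in> M \<rightarrow>\<^sub>M prob_algebra N"
    and f: "square_integrable (M \<bind> K) f"
  shows AE_square_integrable_kernel: "AE x in M. square_integrable (K x) f"
    and square_integrable_kernel_op: "square_integrable M (kernel_op K f)"
    and integral_kernel_op: "(\<integral>x. kernel_op K f x \<partial>M) = (\<integral>x. f x \<partial>(M \<bind> K))"
    and integrable_kernel_op_square: "integrable M (kernel_op K (\<lambda>y. (f y)\<^sup>2))"
    and integral_kernel_op_square: "(\<integral>x. kernel_op K (\<lambda>y. (f y)\<^sup>2) x \<partial>M) = (\<integral>x. (f x)\<^sup>2 \<partial>(M \<bind> K))"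
proof -
  interpret M: prob_space M by fact
  note K' = measurable_prob_algebraD[OF K]
  have setsK: "sets (K x) = sets N" "prob_space (K x)" if "x \<in> space M" for x
    using measurable_space[OF K that] by (auto simp: space_prob_algebra)
  have prob: "prob_space (M \<bind> K)"
    using setsK by (intro M.prob_space_bind[OF _ K']) auto
  interpret MK: prob_space "M \<bind> K" by fact
  have f': "f \<in> borel_measurable N"
    using square_integrable_measurable[OF f] sets_bind[OF sets_kernel[OF K'] M.not_empty]
    by (simp cong: measurable_cong_sets)
  have int: "integrable (M \<bind> K) f" "integrable (M \<bind> K) (\<lambda>x. (f x)\<^sup>2)"
    using f MK.square_integrable_integrable[OF f] by (auto simp: square_integrable_def)
  note I1 = integral_bind_kernel[OF K' M.not_empty int(1)]
    and I2 = integral_bind_kernel[OF K' M.not_empty int(2)]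
  show AE: "AE x in M. square_integrable (K x) f"
    using I2(1) AE_space
    by eventually_elim (use f' setsK in \<open>auto simp: square_integrable_def cong: measurable_cong_sets\<close>)
  have m: "kernel_op K f \<in> borel_measurable M"
    unfolding kernel_op_def by (rule measurable_compose[OF K' integral_measurable_subprob_algebra[OF f']])
  show "square_integrable M (kernel_op K f)"
    unfolding square_integrable_def
  proof (intro conjI m Bochner_Integration.integrable_bound[OF I2(2)])
    \<comment> \<open>Jensen under each \<open>K x\<close>: the square of an average is at most the
      average of the square.\<close>
    show "AE x in M. norm ((kernel_op K f x)\<^sup>2) \<le> norm (\<integral>y. (f y)\<^sup>2 \<partial>K x)"
      using AE AE_space
    proof eventually_elim
      case (elim x)
      then show ?case
        using prob_space.square_integral_ge[OF setsK(2), of x f]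
        by (auto simp: kernel_op_def integral_nonneg)
    qed
  qed (use m in simp)
  show "(\<integral>x. kernel_op K f x \<partial>M) = (\<integral>x. f x \<partial>(M \<bind> K))"
    using I1(3) by (simp add: kernel_op_def)
  show "integrable M (kernel_op K (\<lambda>y. (f y)\<^sup>2))"
    "(\<integral>x. kernel_op K (\<lambda>y. (f y)\<^sup>2) x \<partial>M) = (\<integral>x. (f x)\<^sup>2 \<partial>(M \<bind> K))"
    using I2(2,3) by (simp_all add: kernel_op_def)
qed

lemma kernel_op_L02:
  assumes "prob_space M" "K \<in> M \<rightarrow>\<^sub>M prob_algebra N" "f \<in> L02 (M \<bind> K)"
  shows "kernel_op K f \<in> L02 M"
  using assms square_integrable_kernel_op[OF assms(1,2), of f] integral_kernel_op[OF assms(1,2), of f]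
  by (simp add: L02_iff)



text \<open>Expanding the square gives two equal square terms, because invariance lets the square of
  \<open>f\<close> at the target point integrate like the one at the source, and a cross term; hence
  the factor 2. The double integral is monotone in the kernel and in the increments of
  \<open>f\<close>, which \<open>L2_inner\<close> with \<open>kernel_op\<close> does not
  show.\<close>

lemma dirichlet_form_eq_double_integral:
  assumes M: "prob_space M" and K: "K \<in> M \<rightarrow>\<^sub>M prob_algebra M" and inv: "M \<bind> K = M"
    and f: "square_integrable M f"
  shows "0 \<le> dirichlet_form M (kernel_op K) f"
    and "(\<integral>\<^sup>+x. \<integral>\<^sup>+y. ennreal ((f x - f y)\<^sup>2) \<partial>K x \<partial>M) = ennreal (2 * dirichlet_form M (kernel_op K) f)"
proof -
  interpret M: prob_space M by fact
  have f': "square_integrable (M \<bind> K) f" unfolding inv by (rule f)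
  \<comment> \<open>The inner integral of the squared difference with the square expanded; this is
    legitimate at those \<open>x\<close> for which \<open>f\<close> is square integrable under
    \<open>K x\<close>.\<close>
  let ?e = "\<lambda>x. (f x)\<^sup>2 - 2 * (f x * kernel_op K f x) + kernel_op K (\<lambda>y. (f y)\<^sup>2) x"
  have AE: "AE x in M. 0 \<le> ?e x \<and> (\<integral>\<^sup>+y. ennreal ((f x - f y)\<^sup>2) \<partial>K x) = ennreal (?e x)"
    using AE_square_integrable_kernel[OF M K f'] AE_space
  proof eventually_elim
    case (elim x)
    interpret Kx: prob_space "K x"
      using measurable_space[OF K elim(2)] by (auto simp: space_prob_algebra)
    have int: "integrable (K x) (\<lambda>y. (f y)\<^sup>2)" "integrable (K x) f"
      using elim(1) Kx.square_integrable_integrable[OF elim(1)] by (auto simp: square_integrable_def)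
    then have "integrable (K x) (\<lambda>y. (f x - f y)\<^sup>2)" "(\<integral>y. (f x - f y)\<^sup>2 \<partial>K x) = ?e x"
      by (simp_all add: power2_diff kernel_op_def Kx.prob_space)
    then show ?case
      using nn_integral_eq_integral[of "K x" "\<lambda>y. (f x - f y)\<^sup>2"]
        Bochner_Integration.integral_nonneg[of "K x" "\<lambda>y. (f x - f y)\<^sup>2"]
      by (metis AE_I2 zero_le_power2)
  qed
  have prod: "integrable M (\<lambda>x. f x * kernel_op K f x)"
    by (rule square_integrable_mult[OF f square_integrable_kernel_op[OF M K f']])
  have sq: "integrable M (\<lambda>x. (f x)\<^sup>2)"
    using f by (simp add: square_integrable_def)
  note Ksq = integrable_kernel_op_square[OF M K f']
  have int: "integrable M ?e"
    using prod sq Ksq by simp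
  have eq: "(\<integral>x. ?e x \<partial>M) = 2 * dirichlet_form M (kernel_op K) f"
    using prod sq Ksq integral_kernel_op_square[OF M K f'] inv
    by (simp add: dirichlet_form_def L2_norm_square L2_inner_def)
  have "0 \<le> (\<integral>x. ?e x \<partial>M)"
    using AE by (intro integral_nonneg_AE) auto
  then show "0 \<le> dirichlet_form M (kernel_op K) f"
    using eq by simp
  have "(\<integral>\<^sup>+x. \<integral>\<^sup>+y. ennreal ((f x - f y)\<^sup>2) \<partial>K x \<partial>M) = (\<integral>\<^sup>+x. ennreal (?e x) \<partial>M)"
    using AE by (intro nn_integral_cong_AE) auto
  also have "\<dots> = ennreal (2 * dirichlet_form M (kernel_op K) f)"
    using AE by (subst nn_integral_eq_integral[OF int]) (auto simp: eq)
  finally show "(\<integral>\<^sup>+x. \<integral>\<^sup>+y. ennreal ((f x - f y)\<^sup>2) \<partial>K x \<partial>M) = ennreal (2 * dirichlet_form M (kernel_op K) f)" .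
qed

subsection \<open>Riesz representation and adjoints\<close>

text \<open>For a > 0 evaluate at the vertex. The degenerate case a = 0 must be included because the
  leading coefficient will be a squared norm that may vanish; there a nonzero b is refuted by the
  point where the affine function takes the value -1.\<close>

lemma nonneg_quadratic_discriminant:
  fixes a b c :: real
  assumes "\<And>t. 0 \<le> a * t\<^sup>2 + 2 * b * t + c" and a: "0 \<le> a"
  shows "b\<^sup>2 \<le> a * c"
proof (cases "a = 0")
  case True
  show ?thesis
  proof (cases "b = 0")
    case False
    then show ?thesis
      using assms(1)[of "- (c + 1) / (2 * b)"] True by (simp add: field_simps)
  qed (use True in simp)
next
  case False
  have "a * (- b / a)\<^sup>2 + 2 * b * (- b / a) + c = c - b\<^sup>2 / a"
    using False by (simp add: field_simps power2_eq_square)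
  then have "b\<^sup>2 / a \<le> c"
    using assms(1)[of "- b / a"] by simp
  then show ?thesis
    using False a by (simp add: field_simps)
qed

lemma square_integrable_Cauchy_Schwarz:
  assumes f: "square_integrable M f" and g: "square_integrable M g"
  shows "(\<integral>x. f x * g x \<partial>M)\<^sup>2 \<le> (\<integral>x. (f x)\<^sup>2 \<partial>M) * (\<integral>x. (g x)\<^sup>2 \<partial>M)"
proof (rule nonneg_quadratic_discriminant)
  fix t
  have [simp]: "integrable M (\<lambda>x. (f x)\<^sup>2)" "integrable M (\<lambda>x. (g x)\<^sup>2)" "integrable M (\<lambda>x. f x * g x)"
    using f g square_integrable_mult[OF f g] by (auto simp: square_integrable_def)
  have "0 \<le> (\<integral>x. (f x * t + g x)\<^sup>2 \<partial>M)"
    by simp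
  also have "\<dots> = (\<integral>x. (f x)\<^sup>2 * t\<^sup>2 + 2 * (f x * g x) * t + (g x)\<^sup>2 \<partial>M)"
    by (intro Bochner_Integration.integral_cong) (auto simp: power2_eq_square algebra_simps)
  also have "\<dots> = (\<integral>x. (f x)\<^sup>2 \<partial>M) * t\<^sup>2 + 2 * (\<integral>x. f x * g x \<partial>M) * t + (\<integral>x. (g x)\<^sup>2 \<partial>M)"
    by simp
  finally show "0 \<le> (\<integral>x. (f x)\<^sup>2 \<partial>M) * t\<^sup>2 + 2 * (\<integral>x. f x * g x \<partial>M) * t + (\<integral>x. (g x)\<^sup>2 \<partial>M)" .
qed simp

lemma (in prob_space)
  shows L02_add: "f \<in> L02 M \<Longrightarrow> g \<in> L02 M \<Longrightarrow> (\<lambda>x. f x + g x) \<in> L02 M"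
    and L02_cmult: "f \<in> L02 M \<Longrightarrow> (\<lambda>x. c * f x) \<in> L02 M"
    and L02_diff: "f \<in> L02 M \<Longrightarrow> g \<in> L02 M \<Longrightarrow> (\<lambda>x. f x - g x) \<in> L02 M"
  using square_integrable_add[of M f g] square_integrable_cmult[of M f c]
    square_integrable_diff[of M f g]
  by (auto simp: L02_iff dest!: square_integrable_integrable)

text \<open>The rate 1/4 for squared distances makes the L1 norms of successive differences at most
  powers of 1/2. These are summable, so the sequence converges almost everywhere, and Fatou's lemma
  carries the quantitative bound to the limit.\<close>

lemma (in prob_space) L02_complete:
  fixes f :: "nat \<Rightarrow> 'a \<Rightarrow> real"
  assumes f: "\<And>n. f n \<in> L02 M"
    and cauchy: "\<And>n m. n \<le> m \<Longrightarrow> (\<integral>x. (f n x - f m x)\<^sup>2 \<partial>M) \<le> (1/4)^n"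
  shows "\<exists>g\<in>L02 M. \<forall>n. (\<integral>x. (f n x - g x)\<^sup>2 \<partial>M) \<le> (1/4)^n"
proof -
  have sq: "square_integrable M (f n)" for n
    using f by (simp add: L02_iff)
  note [measurable] = square_integrable_measurable[OF sq]
  let ?d = "\<lambda>n x. \<bar>f n x - f (Suc n) x\<bar>"
  have "(\<integral>\<^sup>+x. (\<Sum>n. ennreal (?d n x)) \<partial>M) = (\<Sum>n. \<integral>\<^sup>+x. ennreal (?d n x) \<partial>M)"
    by (rule nn_integral_suminf) simp
  also have "\<dots> \<le> (\<Sum>n. ennreal ((1/2)^n))"
  proof (intro suminf_le)
    fix n
    have d: "square_integrable M (?d n)"
      using square_integrable_diff[OF sq[of n] sq[of "Suc n"]] by (simp add: square_integrable_def)
    have "(\<integral>x. ?d n x \<partial>M)\<^sup>2 \<le> (\<integral>x. (?d n x)\<^sup>2 \<partial>M)"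
      by (rule square_integral_ge[OF d])
    also have "\<dots> \<le> ((1/2)^n)\<^sup>2"
    proof -
      have "((1/2::real)^n)\<^sup>2 = ((1/2)\<^sup>2)^n"
        by (simp only: power_mult[symmetric] mult.commute)
      then show ?thesis
        using cauchy[of n "Suc n"] by (simp add: power2_eq_square)
    qed
    finally have "(\<integral>x. ?d n x \<partial>M) \<le> (1/2)^n"
      by (rule power2_le_imp_le) simp
    then show "(\<integral>\<^sup>+x. ennreal (?d n x) \<partial>M) \<le> ennreal ((1/2)^n)"
      by (subst nn_integral_eq_integral[OF square_integrable_integrable[OF d]])
        (auto intro: ennreal_leI)
  qed auto
  also have "\<dots> < \<infinity>"
    by (subst suminf_ennreal2) (auto simp: summable_geometric)
  finally have "AE x in M. (\<Sum>n. ennreal (?d n x)) \<noteq> \<infinity>"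
    by (intro nn_integral_PInf_AE) auto
  then have conv: "AE x in M. (\<lambda>n. f n x) \<longlonglongrightarrow> lim (\<lambda>n. f n x)"
  proof eventually_elim
    case (elim x)
    then have "summable (\<lambda>n. ?d n x)"
      by (intro summable_suminf_not_top) auto
    then have "summable (\<lambda>n. f n x - f (Suc n) x)"
      by (rule summable_rabs_cancel)
    then have "convergent (\<lambda>n. \<Sum>k<n. f k x - f (Suc k) x)"
      by (simp add: summable_iff_convergent)
    then have "convergent (\<lambda>n. f 0 x - f n x)"
      by (subst (asm) sum_lessThan_telescope')
    then have "convergent (\<lambda>n. f 0 x - (f 0 x - f n x))"
      by (rule convergent_diff[OF convergent_const])
    then show ?case
      by (simp add: convergent_LIMSEQ_iff)
  qed
  \<comment> \<open>Where the sequence diverges, \<open>lim\<close> is an unspecified value; this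
    happens only on a null set, and measurability holds everywhere.\<close>
  define g where "g = (\<lambda>x. lim (\<lambda>n. f n x))"
  have g[measurable]: "g \<in> borel_measurable M"
    unfolding g_def by measurable
  have nn: "(\<integral>\<^sup>+x. ennreal ((f n x - g x)\<^sup>2) \<partial>M) \<le> ennreal ((1/4)^n)" for n
  proof -
    have "(\<integral>\<^sup>+x. ennreal ((f n x - g x)\<^sup>2) \<partial>M) = (\<integral>\<^sup>+x. liminf (\<lambda>m. ennreal ((f n x - f m x)\<^sup>2)) \<partial>M)"
    proof (intro nn_integral_cong_AE)
      show "AE x in M. ennreal ((f n x - g x)\<^sup>2) = liminf (\<lambda>m. ennreal ((f n x - f m x)\<^sup>2))"
        using conv
      proof eventually_elim
        case (elim x)
        then have "(\<lambda>m. ennreal ((f n x - f m x)\<^sup>2)) \<longlonglongrightarrow> ennreal ((f n x - g x)\<^sup>2)"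
          unfolding g_def by (intro tendsto_ennrealI tendsto_intros)
        then show ?case
          by (rule lim_imp_Liminf[OF sequentially_bot, symmetric])
      qed
    qed
    also have "\<dots> \<le> liminf (\<lambda>m. \<integral>\<^sup>+x. ennreal ((f n x - f m x)\<^sup>2) \<partial>M)"
      by (rule nn_integral_liminf) simp
    also have "\<dots> \<le> ennreal ((1/4)^n)"
    proof (rule Liminf_le)
      show "\<forall>\<^sub>F m in sequentially. (\<integral>\<^sup>+x. ennreal ((f n x - f m x)\<^sup>2) \<partial>M) \<le> ennreal ((1/4)^n)"
        using eventually_ge_at_top[of n]
      proof eventually_elim
        case (elim m)
        show ?case
          using cauchy[OF elim] square_integrable_diff[OF sq[of n] sq[of m]]
          by (subst nn_integral_eq_integral) (auto simp: square_integrable_def intro!: ennreal_leI)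
      qed
    qed simp
    finally show ?thesis .
  qed
  have diff: "square_integrable M (\<lambda>x. f n x - g x)" for n
    using nn[of n] unfolding square_integrable_def
    by (auto intro!: integrableI_nonneg simp: le_less_trans)
  have le: "(\<integral>x. (f n x - g x)\<^sup>2 \<partial>M) \<le> (1/4)^n" for n
    using nn[of n] diff[of n]
    by (subst (asm) nn_integral_eq_integral) (auto simp: square_integrable_def)
  have sq_g: "square_integrable M g"
    using square_integrable_diff[OF sq[of 0] diff[of 0]] by simp
  \<comment> \<open>The terms have mean zero, so the mean of \<open>g\<close> is minus that of the
    difference; Jensen bounds it by a quantity that tends to 0 with \<open>n\<close>.\<close>
  have "(\<integral>x. g x \<partial>M)\<^sup>2 \<le> (1/4)^n" for n
  proof -
    have "(\<integral>x. f n x - g x \<partial>M) = - (\<integral>x. g x \<partial>M)"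
      using f[of n] square_integrable_integrable[OF sq[of n]] square_integrable_integrable[OF sq_g]
      by (simp add: L02_iff)
    then show ?thesis
      using square_integral_ge[OF diff[of n]] le[of n] by simp
  qed
  moreover have "(\<lambda>n. (1/4::real)^n) \<longlonglongrightarrow> 0"
    by (rule LIMSEQ_realpow_zero) auto
  ultimately have "(\<integral>x. g x \<partial>M)\<^sup>2 \<le> 0"
    by (intro LIMSEQ_le_const) auto
  then have "g \<in> L02 M"
    using sq_g by (simp add: L02_iff)
  with le show ?thesis
    by blast
qed

text \<open>
  The representing function minimizes \<open>\<lambda>f. (\<integral>x. (f x)\<^sup>2 \<partial>M) - 2 * L f\<close>; by the parallelogram
  identity every minimizing sequence is Cauchy.
\<close>

lemma (in prob_space) L02_riesz:
  fixes L :: "('a \<Rightarrow> real) \<Rightarrow> real"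
  assumes add: "\<And>f g. f \<in> L02 M \<Longrightarrow> g \<in> L02 M \<Longrightarrow> L (\<lambda>x. f x + g x) = L f + L g"
    and scale: "\<And>f c. f \<in> L02 M \<Longrightarrow> L (\<lambda>x. c * f x) = c * L f"
    and C: "0 \<le> C" and bounded: "\<And>f. f \<in> L02 M \<Longrightarrow> (L f)\<^sup>2 \<le> C * (\<integral>x. (f x)\<^sup>2 \<partial>M)"
  shows "\<exists>g\<in>L02 M. \<forall>f\<in>L02 M. L f = (\<integral>x. f x * g x \<partial>M)"
proof -
  define N where "N f = (\<integral>x. (f x)\<^sup>2 \<partial>M)" for f :: "'a \<Rightarrow> real"
  define J where "J f = N f - 2 * L f" for f
  define m where "m = Inf (J ` L02 M)"
  have sq: "square_integrable M f" if "f \<in> L02 M" for f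
    using that by (simp add: L02_iff)
  have N_lin: "N (\<lambda>x. f x + t * h x) = N f + 2 * t * (\<integral>x. f x * h x \<partial>M) + t\<^sup>2 * N h"
    if f: "f \<in> L02 M" and h: "h \<in> L02 M" for f h t
  proof -
    note [simp] = square_integrable_mult[OF sq[OF f] sq[OF h]]
      square_integrable_integrable_square[OF sq[OF f]] square_integrable_integrable_square[OF sq[OF h]]
    have "N (\<lambda>x. f x + t * h x) = (\<integral>x. (f x)\<^sup>2 + 2 * t * (f x * h x) + t\<^sup>2 * (h x)\<^sup>2 \<partial>M)"
      unfolding N_def by (intro Bochner_Integration.integral_cong) (auto simp: power2_eq_square algebra_simps)
    also have "\<dots> = N f + 2 * t * (\<integral>x. f x * h x \<partial>M) + t\<^sup>2 * N h"
      by (simp add: N_def)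
    finally show ?thesis .
  qed
  have zero_le_quarter: "0 \<le> (1/4::real)" and quarter_le_one: "1/4 \<le> (1::real)"
    by simp_all
  have J_lin: "J (\<lambda>x. f x + t * h x) = J f + 2 * t * ((\<integral>x. f x * h x \<partial>M) - L h) + t\<^sup>2 * N h"
    if f: "f \<in> L02 M" and h: "h \<in> L02 M" for f h t
    using N_lin[OF f h, of t] add[OF f L02_cmult[OF h, of t]] scale[OF h, of t]
    by (simp add: J_def algebra_simps)
  \<comment> \<open>\<open>L f\<close> is at most the product of the square roots of
    \<open>C\<close> and \<open>N f\<close>, and twice that product is at most
    \<open>C + N f\<close>.\<close>
  have "- C \<le> J f" if "f \<in> L02 M" for f
  proof -
    have N: "0 \<le> N f" by (simp add: N_def)
    have "\<bar>L f\<bar> \<le> sqrt C * sqrt (N f)"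
      using bounded[OF that] by (simp add: N_def flip: real_sqrt_mult real_sqrt_abs)
    moreover have "0 \<le> (sqrt C - sqrt (N f))\<^sup>2" by simp
    ultimately have "0 \<le> C + N f - 2 * L f"
      using C N by (simp add: power2_diff)
    then show ?thesis by (simp add: J_def)
  qed
  then have bdd: "bdd_below (J ` L02 M)"
    by (intro bdd_belowI2)
  have m_le: "m \<le> J f" if "f \<in> L02 M" for f
    unfolding m_def using that by (intro cINF_lower bdd)
  have ne: "J ` L02 M \<noteq> {}"
    by (auto simp: L02_def intro!: exI[of _ "\<lambda>_. 0"])
  \<comment> \<open>The extra factor 1/4 in the slack pays for the factors 2 in the parallelogram
    estimate, so that exactly the rate required by \<open>L02_complete\<close> comes out.\<close>
  have "\<exists>f. f \<in> L02 M \<and> J f < m + (1/4)^n / 4" for n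
    using cInf_lessD[OF ne, of "m + (1/4)^n / 4"] by (auto simp: m_def)
  then obtain F where F: "\<And>n. F n \<in> L02 M" and JF: "\<And>n. J (F n) < m + (1/4)^n / 4"
    by metis
  have cauchy: "(\<integral>x. (F n x - F k x)\<^sup>2 \<partial>M) \<le> (1/4)^n" if "n \<le> k" for n k
  proof -
    have h: "(\<lambda>x. F k x - F n x) \<in> L02 M"
      by (rule L02_diff[OF F F])
    define A D where "A = (\<integral>x. F n x * (F k x - F n x) \<partial>M) - L (\<lambda>x. F k x - F n x)"
      and "D = N (\<lambda>x. F k x - F n x)"
    have "J (F k) = J (F n) + 2 * A + D"
      using J_lin[OF F h, of n 1] by (simp add: A_def D_def)
    \<comment> \<open>Testing the infimum at the midpoint of \<open>F n\<close> and
      \<open>F k\<close> gives a second relation between \<open>A\<close> and \<open>D\<close>;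
      eliminating \<open>A\<close> bounds the squared distance \<open>D\<close> by the two excesses
      over \<open>m\<close>.\<close>
    moreover have "m \<le> J (\<lambda>x. F n x + 1/2 * (F k x - F n x))"
      by (intro m_le L02_add[OF F L02_cmult[OF h]])
    then have "m \<le> J (F n) + A + D / 4"
      using J_lin[OF F h, of n "1/2"] by (simp add: A_def D_def power2_eq_square)
    ultimately have "D \<le> 2 * (J (F n) - m) + 2 * (J (F k) - m)"
      by argo
    also have "\<dots> \<le> (1/4)^n / 2 + (1/4)^k / 2"
      using JF[of n] JF[of k] by argo
    also have "\<dots> \<le> (1/4)^n"
      using power_decreasing[OF that zero_le_quarter quarter_le_one] by argo
    finally show ?thesis
      by (simp add: D_def N_def power2_commute)
  qed
  obtain g where g: "g \<in> L02 M" and Fg: "\<And>n. (\<integral>x. (F n x - g x)\<^sup>2 \<partial>M) \<le> (1/4)^n"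
    using L02_complete[of F, OF F cauchy] by auto
  have "L h = (\<integral>x. h x * g x \<partial>M)" if h: "h \<in> L02 M" for h
  proof -
    let ?a = "\<lambda>n. (\<integral>x. F n x * h x \<partial>M)"
    have Nh: "0 \<le> N h" by (simp add: N_def)
    have tendsto: "b \<longlonglongrightarrow> 0" if "\<And>n. (b n)\<^sup>2 \<le> N h * (1/4)^n" for b :: "nat \<Rightarrow> real"
    proof -
      have "(\<lambda>n. N h * (1/4)^n) \<longlonglongrightarrow> 0"
        by (intro tendsto_mult_right_zero LIMSEQ_realpow_zero) auto
      then have "(\<lambda>n. (b n)\<^sup>2) \<longlonglongrightarrow> 0"
        by (rule tendsto_sandwich[where f="\<lambda>_. 0", rotated 3]) (simp_all add: that)
      then show ?thesis
        using tendsto_real_sqrt[of "\<lambda>n. (b n)\<^sup>2" 0] by (simp add: tendsto_rabs_zero_iff)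
    qed
    have 1: "(\<lambda>n. ?a n - L h) \<longlonglongrightarrow> 0"
    proof (rule tendsto)
      fix n
      \<comment> \<open>First-order condition for an approximate minimizer: moving from
        \<open>F n\<close> along \<open>h\<close> by any \<open>t\<close> cannot lower
        \<open>J\<close> by more than the slack, so a quadratic in \<open>t\<close> is nonnegative
        and its discriminant bounds the derivative.\<close>
      have "(?a n - L h)\<^sup>2 \<le> N h * ((1/4)^n / 4)"
      proof (rule nonneg_quadratic_discriminant)
        fix t
        have "m \<le> J (\<lambda>x. F n x + t * h x)"
          by (intro m_le L02_add[OF F L02_cmult[OF h]])
        then show "0 \<le> N h * t\<^sup>2 + 2 * (?a n - L h) * t + (1/4)^n / 4"
          using JF[of n] unfolding J_lin[OF F h] by argo
      qed (rule Nh)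
      also have "\<dots> \<le> N h * (1/4)^n"
        using Nh by (intro mult_left_mono) auto
      finally show "(?a n - L h)\<^sup>2 \<le> N h * (1/4)^n" .
    qed
    have 2: "(\<lambda>n. ?a n - (\<integral>x. h x * g x \<partial>M)) \<longlonglongrightarrow> 0"
    proof (rule tendsto)
      fix n
      have "?a n - (\<integral>x. h x * g x \<partial>M) = (\<integral>x. h x * (F n x - g x) \<partial>M)"
        using square_integrable_mult[OF sq[OF h] sq[OF g]] square_integrable_mult[OF sq[OF h] sq[OF F]]
        by (simp add: right_diff_distrib mult.commute)
      then have "(?a n - (\<integral>x. h x * g x \<partial>M))\<^sup>2 = (\<integral>x. h x * (F n x - g x) \<partial>M)\<^sup>2"
        by (rule arg_cong)
      also have "\<dots> \<le> N h * (\<integral>x. (F n x - g x)\<^sup>2 \<partial>M)"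
        unfolding N_def by (intro square_integrable_Cauchy_Schwarz square_integrable_diff sq h F g)
      also have "\<dots> \<le> N h * (1/4)^n"
        by (intro mult_left_mono Fg Nh)
      finally show "(?a n - (\<integral>x. h x * g x \<partial>M))\<^sup>2 \<le> N h * (1/4)^n" .
    qed
    show ?thesis
      using tendsto_diff[OF 1 2] by (simp add: LIMSEQ_const_iff)
  qed
  with g show ?thesis
    by blast
qed

text \<open>Testing with the difference \<open>g - h\<close> itself makes its squared norm
  vanish.\<close>

lemma (in prob_space) L02_inner_eq_imp_AE_eq:
  assumes g: "g \<in> L02 M" and h: "h \<in> L02 M"
    and eq: "\<And>f. f \<in> L02 M \<Longrightarrow> L2_inner M f g = L2_inner M f h"
  shows "AE x in M. g x = h x"
proof -
  let ?d = "\<lambda>x. g x - h x"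
  have d: "?d \<in> L02 M"
    by (rule L02_diff[OF g h])
  have sq: "square_integrable M g" "square_integrable M h" "square_integrable M ?d"
    using g h d by (simp_all add: L02_iff)
  have "(\<integral>x. (?d x)\<^sup>2 \<partial>M) = (\<integral>x. ?d x * g x - ?d x * h x \<partial>M)"
    by (intro Bochner_Integration.integral_cong) (auto simp: power2_eq_square algebra_simps)
  also have "\<dots> = L2_inner M ?d g - L2_inner M ?d h"
    unfolding L2_inner_def
    by (intro Bochner_Integration.integral_diff square_integrable_mult sq)
  also have "\<dots> = 0"
    using eq[OF d] by simp
  finally have "AE x in M. (?d x)\<^sup>2 = 0"
    using square_integrable_integrable_square[OF sq(3)]
    by (subst (asm) integral_nonneg_eq_0_iff_AE) auto
  then show ?thesis
    by eventually_elim simp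
qed

section \<open>Adjoints of contractions between spaces of centered square-integrable
  functions\<close>

lemma L02_linearD:
  assumes "L02_linear \<rho> \<sigma> T"
  shows "f \<in> L02 \<rho> \<Longrightarrow> T f \<in> L02 \<sigma>"
    and "f \<in> L02 \<rho> \<Longrightarrow> g \<in> L02 \<rho> \<Longrightarrow> AE x in \<rho>. f x = g x \<Longrightarrow> AE y in \<sigma>. T f y = T g y"
    and "f \<in> L02 \<rho> \<Longrightarrow> g \<in> L02 \<rho> \<Longrightarrow> AE y in \<sigma>. T (\<lambda>x. f x + g x) y = T f y + T g y"
    and "f \<in> L02 \<rho> \<Longrightarrow> AE y in \<sigma>. T (\<lambda>x. c * f x) y = c * T f y"
  using assms by (auto simp: L02_linear_def)

lemma L2_inner_cong_AE:
  assumes "square_integrable M f" "square_integrable M f'" "square_integrable M g" "square_integrable M g'"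
    and "AE x in M. f x = f' x" "AE x in M. g x = g' x"
  shows "L2_inner M f g = L2_inner M f' g'"
  unfolding L2_inner_def
proof (intro integral_cong_AE)
  show "AE x in M. f x * g x = f' x * g' x"
    using assms(5,6) by eventually_elim simp
qed (use assms in \<open>auto simp: square_integrable_def\<close>)

lemma L2_inner_add_left:
  assumes "square_integrable M f" "square_integrable M g" "square_integrable M h"
  shows "L2_inner M (\<lambda>x. f x + g x) h = L2_inner M f h + L2_inner M g h"
  using square_integrable_mult[OF assms(1,3)] square_integrable_mult[OF assms(2,3)]
  by (simp add: L2_inner_def distrib_right)

lemma L2_inner_cmult_left: "L2_inner M (\<lambda>x. c * f x) h = c * L2_inner M f h"
  by (simp add: L2_inner_def mult.assoc)

lemma L2_inner_commute: "L2_inner M f g = L2_inner M g f"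
  by (simp add: L2_inner_def mult.commute)

lemma L2_norm_le_imp_integral_le:
  assumes "L2_norm M f \<le> L2_norm N g"
  shows "(\<integral>x. (f x)\<^sup>2 \<partial>M) \<le> (\<integral>x. (g x)\<^sup>2 \<partial>N)"
  using assms by (simp add: L2_norm_def L2_inner_def power2_eq_square)

text \<open>For fixed \<open>h\<close> the functional sending \<open>f\<close> to the inner product
  of \<open>T f\<close> with \<open>h\<close> is linear up to null sets and bounded by
  Cauchy-Schwarz and the contraction property, so it has a Riesz representative. This provides the
  witness that the choice in \<open>L02_adjoint\<close> requires.\<close>

lemma L02_adjoint:
  assumes \<rho>: "prob_space \<rho>" and \<sigma>: "prob_space \<sigma>" and T: "L02_linear \<rho> \<sigma> T"
    and contr: "\<And>f. f \<in> L02 \<rho> \<Longrightarrow> L2_norm \<sigma> (T f) \<le> L2_norm \<rho> f"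
  shows "L02_linear \<sigma> \<rho> (L02_adjoint \<rho> \<sigma> T)"
    and "f \<in> L02 \<rho> \<Longrightarrow> h \<in> L02 \<sigma> \<Longrightarrow> L2_inner \<sigma> (T f) h = L2_inner \<rho> f (L02_adjoint \<rho> \<sigma> T h)"
proof -
  interpret \<rho>: prob_space \<rho> by fact
  interpret \<sigma>: prob_space \<sigma> by fact
  have sq: "square_integrable M f" if "f \<in> L02 M" for f :: "'c \<Rightarrow> real" and M
    using that by (simp add: L02_iff)
  note TD = L02_linearD[OF T]
  have "\<exists>u\<in>L02 \<rho>. \<forall>f\<in>L02 \<rho>. L2_inner \<sigma> (T f) h = L2_inner \<rho> f u" if h: "h \<in> L02 \<sigma>" for h
    unfolding L2_inner_def[of \<rho>]
  proof (rule \<rho>.L02_riesz)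
    fix f g assume f: "f \<in> L02 \<rho>" and g: "g \<in> L02 \<rho>"
    have "L2_inner \<sigma> (T (\<lambda>x. f x + g x)) h = L2_inner \<sigma> (\<lambda>y. T f y + T g y) h"
      using TD(1)[OF f] TD(1)[OF g] TD(1)[OF \<rho>.L02_add[OF f g]] h TD(3)[OF f g]
      by (intro L2_inner_cong_AE square_integrable_add sq) auto
    also have "\<dots> = L2_inner \<sigma> (T f) h + L2_inner \<sigma> (T g) h"
      by (intro L2_inner_add_left sq TD(1) f g h)
    finally show "L2_inner \<sigma> (T (\<lambda>x. f x + g x)) h = L2_inner \<sigma> (T f) h + L2_inner \<sigma> (T g) h" .
  next
    fix f c assume f: "f \<in> L02 \<rho>"
    have "L2_inner \<sigma> (T (\<lambda>x. c * f x)) h = L2_inner \<sigma> (\<lambda>y. c * T f y) h"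
      using TD(1)[OF f] TD(1)[OF \<rho>.L02_cmult[OF f]] h TD(4)[OF f]
      by (intro L2_inner_cong_AE square_integrable_cmult sq) auto
    then show "L2_inner \<sigma> (T (\<lambda>x. c * f x)) h = c * L2_inner \<sigma> (T f) h"
      by (simp add: L2_inner_cmult_left)
  next
    fix f assume f: "f \<in> L02 \<rho>"
    have "(L2_inner \<sigma> (T f) h)\<^sup>2 \<le> (\<integral>y. (T f y)\<^sup>2 \<partial>\<sigma>) * (\<integral>y. (h y)\<^sup>2 \<partial>\<sigma>)"
      unfolding L2_inner_def by (intro square_integrable_Cauchy_Schwarz sq TD(1) f h)
    also have "\<dots> \<le> (\<integral>x. (f x)\<^sup>2 \<partial>\<rho>) * (\<integral>y. (h y)\<^sup>2 \<partial>\<sigma>)"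
      by (intro mult_right_mono L2_norm_le_imp_integral_le contr f) simp
    finally show "(L2_inner \<sigma> (T f) h)\<^sup>2 \<le> (\<integral>y. (h y)\<^sup>2 \<partial>\<sigma>) * (\<integral>x. (f x)\<^sup>2 \<partial>\<rho>)"
      by (simp add: mult.commute)
  qed simp
  then obtain U where U: "\<And>h. h \<in> L02 \<sigma> \<Longrightarrow> U h \<in> L02 \<rho>"
    and UT: "\<And>h f. h \<in> L02 \<sigma> \<Longrightarrow> f \<in> L02 \<rho> \<Longrightarrow> L2_inner \<sigma> (T f) h = L2_inner \<rho> f (U h)"
    by metis
  \<comment> \<open>The values of \<open>U\<close> were chosen independently for each
    \<open>h\<close>. Additivity, homogeneity and compatibility with null sets come back from the
    uniqueness of representatives up to null sets.\<close>
  have "L02_linear \<sigma> \<rho> U"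
    unfolding L02_linear_def
  proof (intro conjI ballI allI impI)
    fix h k assume h: "h \<in> L02 \<sigma>" and k: "k \<in> L02 \<sigma>"
    show "AE x in \<rho>. U h x = U k x" if "AE y in \<sigma>. h y = k y"
    proof (rule \<rho>.L02_inner_eq_imp_AE_eq[OF U[OF h] U[OF k]])
      fix f assume f: "f \<in> L02 \<rho>"
      have "L2_inner \<sigma> (T f) h = L2_inner \<sigma> (T f) k"
        using that by (intro L2_inner_cong_AE sq TD(1) f h k) auto
      then show "L2_inner \<rho> f (U h) = L2_inner \<rho> f (U k)"
        using UT f h k by simp
    qed
    note hk = \<sigma>.L02_add[OF h k]
    show "AE x in \<rho>. U (\<lambda>y. h y + k y) x = U h x + U k x"
    proof (rule \<rho>.L02_inner_eq_imp_AE_eq[OF U[OF hk] \<rho>.L02_add[OF U[OF h] U[OF k]]])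
      fix f assume f: "f \<in> L02 \<rho>"
      show "L2_inner \<rho> f (U (\<lambda>y. h y + k y)) = L2_inner \<rho> f (\<lambda>x. U h x + U k x)"
        using UT[OF hk f] UT[OF h f] UT[OF k f]
          L2_inner_add_left[OF sq[OF h] sq[OF k] sq[OF TD(1)[OF f]]]
          L2_inner_add_left[OF sq[OF U[OF h]] sq[OF U[OF k]] sq[OF f]]
        by (simp add: L2_inner_commute)
    qed
  next
    fix h c assume h: "h \<in> L02 \<sigma>"
    note ch = \<sigma>.L02_cmult[OF h, of c]
    show "AE x in \<rho>. U (\<lambda>y. c * h y) x = c * U h x"
    proof (rule \<rho>.L02_inner_eq_imp_AE_eq[OF U[OF ch] \<rho>.L02_cmult[OF U[OF h]]])
      fix f assume f: "f \<in> L02 \<rho>"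
      show "L2_inner \<rho> f (U (\<lambda>y. c * h y)) = L2_inner \<rho> f (\<lambda>x. c * U h x)"
        using UT[OF ch f] UT[OF h f] L2_inner_cmult_left[of \<sigma> c h "T f"]
          L2_inner_cmult_left[of \<rho> c "U h" f]
        by (simp add: L2_inner_commute)
    qed
  qed (rule U)
  then have "L02_linear \<sigma> \<rho> U \<and> (\<forall>f\<in>L02 \<rho>. \<forall>h\<in>L02 \<sigma>. L2_inner \<sigma> (T f) h = L2_inner \<rho> f (U h))"
    using UT by blast
  then have spec: "L02_linear \<sigma> \<rho> (L02_adjoint \<rho> \<sigma> T) \<and>
      (\<forall>f\<in>L02 \<rho>. \<forall>h\<in>L02 \<sigma>. L2_inner \<sigma> (T f) h = L2_inner \<rho> f (L02_adjoint \<rho> \<sigma> T h))"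
    unfolding L02_adjoint_def
    by (rule someI[where P="\<lambda>U. L02_linear \<sigma> \<rho> U \<and>
      (\<forall>f\<in>L02 \<rho>. \<forall>h\<in>L02 \<sigma>. L2_inner \<sigma> (T f) h = L2_inner \<rho> f (U h))"])
  then show "L02_linear \<sigma> \<rho> (L02_adjoint \<rho> \<sigma> T)"
    and "f \<in> L02 \<rho> \<Longrightarrow> h \<in> L02 \<sigma> \<Longrightarrow> L2_inner \<sigma> (T f) h = L2_inner \<rho> f (L02_adjoint \<rho> \<sigma> T h)"
    by blast+
qed

subsection \<open>Oscillation\<close>

text \<open>Replaces an extended-real bound by an interval of length \<open>D\<close>. In this form
  the bound can be restricted to fibers and shifted by constants; the left end point is the
  essential infimum.\<close>

lemma osc_norm_leD:
  assumes M: "prob_space M" and osc: "osc_norm M f \<le> ereal D"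
  shows "\<exists>a. AE x in M. a \<le> f x \<and> f x \<le> a + D"
proof -
  interpret prob_space M by fact
  define s i where "s = esssup M (\<lambda>x. ereal (f x))" and "i = essinf M (\<lambda>x. ereal (f x))"
  have AE: "AE x in M. i \<le> ereal (f x) \<and> ereal (f x) \<le> s"
    using esssup_AE[where f="\<lambda>x. ereal (f x)"] esssup_AE[where f="\<lambda>x. - ereal (f x)"]
    by eventually_elim (simp add: s_def i_def essinf_def ereal_uminus_le_reorder)
  \<comment> \<open>One real value between \<open>i\<close> and \<open>s\<close> rules out i =
    \<infinity> and s = -\<infinity>; the bound on \<open>s - i\<close> then makes both
    finite.\<close>
  then obtain x where x: "i \<le> ereal (f x)" "ereal (f x) \<le> s"
    using eventually_happens[OF AE] ae_filter_eq_bot_iff emeasure_space_1 by force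
  have "s - i \<le> ereal D"
    using osc by (simp add: osc_norm_def s_def i_def)
  with x obtain a b where ab: "i = ereal a" "s = ereal b" "b \<le> a + D"
    by (cases i; cases s) auto
  have "AE x in M. a \<le> f x \<and> f x \<le> a + D"
    using AE by eventually_elim (use ab in auto)
  then show ?thesis
    by blast
qed

lemma osc_norm_leI:
  assumes "f \<in> borel_measurable M" and AE: "AE x in M. a \<le> f x \<and> f x \<le> a + D"
  shows "osc_norm M f \<le> ereal D"
proof -
  have 1: "esssup M (\<lambda>x. ereal (f x)) \<le> ereal (a + D)"
    using assms by (intro esssup_I) (auto elim!: eventually_mono)
  have "esssup M (\<lambda>x. - ereal (f x)) \<le> ereal (- a)"
    using assms by (intro esssup_I) (auto elim!: eventually_mono)
  then have 2: "ereal a \<le> essinf M (\<lambda>x. ereal (f x))"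
    unfolding essinf_def by (metis ereal_minus_le_minus uminus_ereal.simps(1) minus_minus)
  show ?thesis
    using ereal_minus_mono[OF 1 2] by (simp add: osc_norm_def)
qed

text \<open>A negative oscillation would confine \<open>f\<close> almost everywhere to an interval
  of negative length.\<close>

lemma osc_norm_nonneg:
  assumes M: "prob_space M"
  shows "0 \<le> osc_norm M f"
proof (rule ccontr)
  interpret prob_space M by fact
  assume "\<not> 0 \<le> osc_norm M f"
  then obtain r where r: "osc_norm M f \<le> ereal r" "r < 0"
    using ereal_dense2[of "osc_norm M f" 0] 
    by (auto simp: not_le zero_ereal_def intro: less_imp_le)
  obtain a where "AE x in M. a \<le> f x \<and> f x \<le> a + r"
    using osc_norm_leD[OF M r(1)] by blast
  then have "AE x in M. False"
    by eventually_elim (use r(2) in linarith)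
  then show False
    by simp
qed

text \<open>Integrate the nonnegative product of the distances to the two ends of the interval;
  since the mean is zero only a constant remains, and it is largest for an interval centered at 0.
  This is the origin of the constant 1/4 in \<open>beta_tilde\<close>.\<close>

lemma (in prob_space) popoviciu:
  assumes f: "f \<in> L02 M" and AE: "AE x in M. a \<le> f x \<and> f x \<le> a + D"
  shows "(\<integral>x. (f x)\<^sup>2 \<partial>M) \<le> D\<^sup>2 / 4"
proof -
  have sq: "square_integrable M f" and mean: "(\<integral>x. f x \<partial>M) = 0"
    using f by (auto simp: L02_iff)
  note [simp] = square_integrable_integrable[OF sq] square_integrable_integrable_square[OF sq]
  have "(\<integral>x. (f x)\<^sup>2 \<partial>M) \<le> (\<integral>x. (2 * a + D) * f x + (- (a * (a + D))) \<partial>M)"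
  proof (intro integral_mono_AE)
    show "AE x in M. (f x)\<^sup>2 \<le> (2 * a + D) * f x + (- (a * (a + D)))"
      using AE
    proof eventually_elim
      case (elim x)
      then have "0 \<le> (f x - a) * (a + D - f x)"
        by (intro mult_nonneg_nonneg) auto
      then show ?case
        by (simp add: power2_eq_square algebra_simps)
    qed
  qed auto
  also have "\<dots> = - (a * (a + D))"
    by (simp add: mean prob_space)
  also have "\<dots> \<le> D\<^sup>2 / 4"
    using zero_le_power2[of "a + D / 2"] by (simp add: power2_eq_square algebra_simps)
  finally show ?thesis .
qed

section \<open>Truncation and Dirichlet forms\<close>

lemma dirichlet_form_contraction:
  assumes M: "prob_space M" and K: "K \<in> M \<rightarrow>\<^sub>M prob_algebra M" and inv: "M \<bind> K = M"
    and f: "square_integrable M f" and g: "square_integrable M g"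
    and le: "\<And>x y. \<bar>g x - g y\<bar> \<le> \<bar>f x - f y\<bar>"
  shows "dirichlet_form M (kernel_op K) g \<le> dirichlet_form M (kernel_op K) f"
proof -
  note F = dirichlet_form_eq_double_integral[OF M K inv f]
    and G = dirichlet_form_eq_double_integral[OF M K inv g]
  have "ennreal (2 * dirichlet_form M (kernel_op K) g) \<le> ennreal (2 * dirichlet_form M (kernel_op K) f)"
    unfolding F(2)[symmetric] G(2)[symmetric]
    using le by (intro nn_integral_mono ennreal_leI) (simp add: abs_le_square_iff)
  then show ?thesis
    using F(1) by simp
qed

text \<open>Truncation destroys mean zero. Subtracting the mean restores it without changing
  differences, so increments are still dominated by those of \<open>f\<close>.\<close>

definition clamp_centered :: "'a measure \<Rightarrow> ('a \<Rightarrow> real) \<Rightarrow> nat \<Rightarrow> 'a \<Rightarrow> real" where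
  "clamp_centered M f n x =
     max (- real n) (min (real n) (f x)) - (\<integral>y. max (- real n) (min (real n) (f y)) \<partial>M)"

lemma (in prob_space)
  assumes f: "f \<in> L02 M"
  shows clamp_centered_L02: "clamp_centered M f n \<in> L02 M"
    and clamp_centered_osc: "osc_norm M (clamp_centered M f n) \<le> ereal (2 * real n)"
    and clamp_centered_contraction: "\<bar>clamp_centered M f n x - clamp_centered M f n y\<bar> \<le> \<bar>f x - f y\<bar>"
    and clamp_centered_tendsto:
      "(\<lambda>n. \<integral>x. (clamp_centered M f n x)\<^sup>2 \<partial>M) \<longlonglongrightarrow> (\<integral>x. (f x)\<^sup>2 \<partial>M)"
proof -
  define t where "t n x = max (- real n) (min (real n) (f x))" for n x
  have c_eq: "clamp_centered M f n = (\<lambda>x. t n x - (\<integral>y. t n y \<partial>M))" for n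
    by (auto simp: clamp_centered_def t_def)
  have sqf: "square_integrable M f" and mean: "(\<integral>x. f x \<partial>M) = 0"
    using f by (auto simp: L02_iff)
  have [measurable]: "f \<in> borel_measurable M"
    by (rule square_integrable_measurable[OF sqf])
  have [measurable]: "t n \<in> borel_measurable M" for n
    unfolding t_def by measurable
  have t_le: "\<bar>t n x\<bar> \<le> \<bar>f x\<bar>" for n x
    unfolding t_def by auto
  have t_sq: "square_integrable M (t n)" for n
    by (rule square_integrable_bound[OF sqf]) (simp_all add: t_le)
  note [simp] = square_integrable_integrable[OF t_sq] square_integrable_integrable_square[OF t_sq]
  show "clamp_centered M f n \<in> L02 M"
    unfolding L02_iff c_eq using square_integrable_diff[OF t_sq square_integrable_const]
    by (simp add: prob_space)
  show "\<bar>clamp_centered M f n x - clamp_centered M f n y\<bar> \<le> \<bar>f x - f y\<bar>"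
    unfolding c_eq t_def by auto
  show "osc_norm M (clamp_centered M f n) \<le> ereal (2 * real n)"
  proof (rule osc_norm_leI)
    show "AE x in M. - real n - (\<integral>y. t n y \<partial>M) \<le> clamp_centered M f n x \<and>
        clamp_centered M f n x \<le> - real n - (\<integral>y. t n y \<partial>M) + 2 * real n"
      by (intro AE_I2) (auto simp: c_eq t_def)
  qed (simp add: c_eq)
  have ev: "\<forall>\<^sub>F n in sequentially. t n x = f x" for x
  proof -
    obtain k :: nat where "\<bar>f x\<bar> \<le> real k"
      using real_arch_simple by blast
    then show ?thesis
      unfolding t_def by (intro eventually_sequentiallyI[of k]) auto
  qed
  have t_lim: "(\<lambda>n. t n x) \<longlonglongrightarrow> f x" for x
    using ev[of x] by (rule tendsto_eventually)
  have "(\<lambda>n. \<integral>x. t n x \<partial>M) \<longlonglongrightarrow> (\<integral>x. f x \<partial>M)"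
    using t_le t_lim square_integrable_integrable[OF sqf]
    by (intro integral_dominated_convergence[where w="\<lambda>x. \<bar>f x\<bar>"]) auto
  moreover have "(\<lambda>n. \<integral>x. (t n x)\<^sup>2 \<partial>M) \<longlonglongrightarrow> (\<integral>x. (f x)\<^sup>2 \<partial>M)"
  proof (intro integral_dominated_convergence[where w="\<lambda>x. (f x)\<^sup>2"])
    show "AE x in M. (\<lambda>n. (t n x)\<^sup>2) \<longlonglongrightarrow> (f x)\<^sup>2"
      by (intro AE_I2 tendsto_power t_lim)
    show "AE x in M. norm ((t n x)\<^sup>2) \<le> (f x)\<^sup>2" for n
      using t_le[of n] by (simp add: abs_le_square_iff)
  qed (use square_integrable_integrable_square[OF sqf] in auto)
  \<comment> \<open>The squared norm after centering is the variance of the truncation; its second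
    moment tends to that of \<open>f\<close> and its mean to the mean of \<open>f\<close>, which is
    0.\<close>
  ultimately have "(\<lambda>n. (\<integral>x. (t n x)\<^sup>2 \<partial>M) - (\<integral>x. t n x \<partial>M)\<^sup>2) \<longlonglongrightarrow> (\<integral>x. (f x)\<^sup>2 \<partial>M) - 0\<^sup>2"
    unfolding mean by (intro tendsto_diff tendsto_power)
  moreover have "(\<integral>x. (clamp_centered M f n x)\<^sup>2 \<partial>M) = (\<integral>x. (t n x)\<^sup>2 \<partial>M) - (\<integral>x. t n x \<partial>M)\<^sup>2" for n
    unfolding c_eq by (rule variance_eq) simp_all
  ultimately show "(\<lambda>n. \<integral>x. (clamp_centered M f n x)\<^sup>2 \<partial>M) \<longlonglongrightarrow> (\<integral>x. (f x)\<^sup>2 \<partial>M)"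
    by simp
qed

subsection \<open>Fibers\<close>

text \<open>\<open>B - {y}\<close> carries no information about the atom at \<open>y\<close>, whence the assumption \<open>F (y, z) = 0\<close>.\<close>

lemma nn_integral_slice_le:
  fixes F :: "'y \<times> 'z \<Rightarrow> ennreal"
  assumes N: "finite_measure N" "sets N = sets MY"
    and M: "finite_measure M" "sets M = sets (MY \<Otimes>\<^sub>M MZ)"
    and y: "{y} \<in> sets MY" and z: "{z} \<in> sets MZ"
    and c: "0 \<le> c"
    and le: "\<And>B. B \<in> sets MY \<Longrightarrow> c * measure N (B - {y}) \<le> measure M ((B - {y}) \<times> {z})"
    and F[measurable]: "F \<in> borel_measurable (MY \<Otimes>\<^sub>M MZ)" and F0: "F (y, z) = 0"
  shows "ennreal c * (\<integral>\<^sup>+y'. F (y', z) \<partial>N) \<le> (\<integral>\<^sup>+p. F p \<partial>M)"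
proof -
  interpret N: finite_measure N by fact
  interpret M: finite_measure M by fact
  note y[measurable]
  have zsp: "z \<in> space MZ"
    using sets.sets_into_space[OF z] by simp
  have [measurable]: "(\<lambda>y'. (y', z)) \<in> MY \<rightarrow>\<^sub>M MY \<Otimes>\<^sub>M MZ"
    using zsp by (intro measurable_Pair) simp_all
  let ?A = "(space MY - {y}) \<times> {z}"
  have [measurable]: "?A \<in> sets (MY \<Otimes>\<^sub>M MZ)"
    using y z by auto
  have cong_N: "borel_measurable N = borel_measurable MY"
    using N(2) by (rule measurable_cong_sets) simp
  have cong_M: "borel_measurable M = borel_measurable (MY \<Otimes>\<^sub>M MZ)"
    using M(2) by (rule measurable_cong_sets) simp
  \<comment> \<open>Both are measures on \<open>MY\<close>: \<open>c\<close> times \<open>N\<close>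
    off the point \<open>y\<close>, and the mass that \<open>M\<close> puts on the slice at
    \<open>z\<close> off \<open>(y, z)\<close>, projected to the first coordinate. The inequality
    for sets says that the first is below the second, and then integrals compare.\<close>
  let ?\<mu> = "density N (\<lambda>y'. ennreal c * indicator (space MY - {y}) y')"
  let ?\<nu> = "distr (density M (indicator ?A)) MY fst"
  have spN: "space N = space MY"
    using N(2) by (rule sets_eq_imp_space_eq)
  have spM: "space M = space MY \<times> space MZ"
    using sets_eq_imp_space_eq[OF M(2)] by (simp add: space_pair_measure)
  have le': "emeasure ?\<mu> B \<le> emeasure ?\<nu> B" if B[measurable]: "B \<in> sets MY" for B
  proof -
    have Bsp: "B \<subseteq> space MY"
      using sets.sets_into_space[OF B] .
    have "emeasure ?\<mu> B = (\<integral>\<^sup>+y'. ennreal c * indicator (space MY - {y}) y' * indicator B y' \<partial>N)"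
      using B by (intro emeasure_density) (simp_all add: cong_N N(2))
    also have "\<dots> = (\<integral>\<^sup>+y'. ennreal c * indicator (B - {y}) y' \<partial>N)"
      by (intro nn_integral_cong) (simp add: spN split: split_indicator)
    also have "\<dots> = ennreal c * emeasure N (B - {y})"
      using B y by (intro nn_integral_cmult_indicator) (simp add: N(2))
    also have "\<dots> = ennreal (c * measure N (B - {y}))"
      using c by (simp add: N.emeasure_eq_measure ennreal_mult)
    also have "\<dots> \<le> ennreal (measure M ((B - {y}) \<times> {z}))"
      by (intro ennreal_leI le B)
    also have "\<dots> = emeasure M ((B - {y}) \<times> {z})"
      by (simp add: M.emeasure_eq_measure)
    also have "\<dots> = (\<integral>\<^sup>+p. indicator ((B - {y}) \<times> {z}) p \<partial>M)"
      using B y z by (intro nn_integral_indicator[symmetric]) (auto simp: M(2))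
    also have "\<dots> = (\<integral>\<^sup>+p. indicator ?A p * indicator (fst -` B \<inter> space M) p \<partial>M)"
    proof (intro nn_integral_cong)
      fix p assume "p \<in> space M"
      then show "(indicator ((B - {y}) \<times> {z}) p :: ennreal) = indicator ?A p * indicator (fst -` B \<inter> space M) p"
        using Bsp by (cases p) (auto simp: spM indicator_def)
    qed
    also have "\<dots> = emeasure (density M (indicator ?A)) (fst -` B \<inter> space M)"
    proof (intro emeasure_density[symmetric])
      have "fst -` B \<inter> space M = B \<times> space MZ"
        using Bsp by (auto simp: spM)
      then show "fst -` B \<inter> space M \<in> sets M"
        using B by (simp add: M(2))
    qed (simp add: cong_M)
    also have "\<dots> = emeasure ?\<nu> B"
      using B by (subst emeasure_distr) (auto cong: measurable_cong_sets simp: M(2))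
    finally show ?thesis .
  qed
  have "ennreal c * (\<integral>\<^sup>+y'. F (y', z) \<partial>N) = (\<integral>\<^sup>+y'. ennreal c * F (y', z) \<partial>N)"
    by (rule nn_integral_cmult[symmetric]) (simp add: cong_N)
  also have "\<dots> = (\<integral>\<^sup>+y'. F (y', z) \<partial>?\<mu>)"
  proof -
    have "(\<integral>\<^sup>+y'. F (y', z) \<partial>?\<mu>) = (\<integral>\<^sup>+y'. ennreal c * indicator (space MY - {y}) y' * F (y', z) \<partial>N)"
      by (rule nn_integral_density) (simp_all add: cong_N)
    also have "\<dots> = (\<integral>\<^sup>+y'. ennreal c * F (y', z) \<partial>N)"
      by (intro nn_integral_cong) (simp add: spN F0 indicator_def)
    finally show ?thesis ..
  qed
  also have "\<dots> \<le> (\<integral>\<^sup>+y'. F (y', z) \<partial>?\<nu>)"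
  proof (rule nn_integral_mono_measure)
    show "?\<mu> \<le> ?\<nu>"
      unfolding le_measure_iff
    proof (simp add: N(2) spN le_fun_def, intro allI)
      \<comment> \<open>The order on measures compares values at all sets; outside the sigma-algebra
        both values are 0 by convention.\<close>
      fix B
      show "emeasure ?\<mu> B \<le> emeasure ?\<nu> B"
      proof (cases "B \<in> sets MY")
        case False
        then show ?thesis
          by (simp add: emeasure_notin_sets N(2))
      qed (rule le')
    qed
  qed (simp add: N(2))
  also have "\<dots> = (\<integral>\<^sup>+p. indicator ?A p * F (fst p, z) \<partial>M)"
  proof -
    have Fz: "(\<lambda>y'. F (y', z)) \<in> borel_measurable MY"
      by measurable
    have "(\<integral>\<^sup>+y'. F (y', z) \<partial>?\<nu>) = (\<integral>\<^sup>+p. F (fst p, z) \<partial>density M (indicator ?A))"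
      by (rule nn_integral_distr) (simp_all add: M(2) Fz cong: measurable_cong_sets)
    also have "\<dots> = (\<integral>\<^sup>+p. indicator ?A p * F (fst p, z) \<partial>M)"
    proof (rule nn_integral_density)
      show "(\<lambda>p. F (fst p, z)) \<in> borel_measurable M"
        unfolding cong_M by (rule measurable_compose[OF measurable_fst Fz])
    qed (simp add: cong_M)
    finally show ?thesis .
  qed
  also have "\<dots> \<le> (\<integral>\<^sup>+p. F p \<partial>M)"
    by (intro nn_integral_mono) (auto simp: indicator_def)
  finally show ?thesis .
qed

section \<open>Disintegration along the second coordinate\<close>

locale disintegrated_measure =
  fixes MY :: "'y measure" and MZ :: "'z measure"
    and \<pi>t :: "('y \<times> 'z) measure" and \<omega> :: "'z measure" and \<kappa> :: "'z \<Rightarrow> 'y measure"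
  assumes prob_pit: "prob_space \<pi>t" and sets_pit: "sets \<pi>t = sets (MY \<Otimes>\<^sub>M MZ)"
    and omega: "\<omega> = distr \<pi>t MZ snd"
    and kappa: "\<kappa> \<in> MZ \<rightarrow>\<^sub>M prob_algebra MY"
    and disintegration: "\<And>A. A \<in> sets (MY \<Otimes>\<^sub>M MZ) \<Longrightarrow>
          emeasure \<pi>t A = (\<integral>\<^sup>+ z. \<integral>\<^sup>+ y. indicator A (y, z) \<partial>\<kappa> z \<partial>\<omega>)"
begin

text \<open>Placing \<open>\<kappa> z\<close> on the fiber over \<open>z\<close> inside the product
  turns the disintegration into a bind, so \<open>fiber_avg\<close> becomes a kernel operator and
  the results on kernels apply.\<close>

definition fiber_kernel :: "'z \<Rightarrow> ('y \<times> 'z) measure" where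
  "fiber_kernel z = distr (\<kappa> z) (MY \<Otimes>\<^sub>M MZ) (\<lambda>y. (y, z))"

lemma sets_omega: "sets \<omega> = sets MZ" and space_omega: "space \<omega> = space MZ"
  by (simp_all add: omega)

lemma snd_measurable_pit: "snd \<in> \<pi>t \<rightarrow>\<^sub>M MZ"
  using measurable_snd[of MY MZ] sets_pit by (simp cong: measurable_cong_sets)

lemma prob_omega: "prob_space \<omega>"
  unfolding omega by (rule prob_space.prob_space_distr[OF prob_pit snd_measurable_pit])

lemma fiber_kernel_measurable: "fiber_kernel \<in> \<omega> \<rightarrow>\<^sub>M prob_algebra (MY \<Otimes>\<^sub>M MZ)"
proof -
  have "(\<lambda>z. distr (\<kappa> z) (MY \<Otimes>\<^sub>M MZ) (\<lambda>y. (y, z))) \<in> MZ \<rightarrow>\<^sub>M prob_algebra (MY \<Otimes>\<^sub>M MZ)"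
    by (rule measurable_distr_prob_space2[OF kappa]) measurable
  then show ?thesis
    unfolding fiber_kernel_def[abs_def] using sets_omega by (simp cong: measurable_cong_sets)
qed

lemma
  assumes "z \<in> space MZ"
  shows prob_kappa: "prob_space (\<kappa> z)" and sets_kappa: "sets (\<kappa> z) = sets MY"
    and pair_measurable_kappa: "(\<lambda>y. (y, z)) \<in> \<kappa> z \<rightarrow>\<^sub>M MY \<Otimes>\<^sub>M MZ"
proof -
  show 1: "prob_space (\<kappa> z)" and 2: "sets (\<kappa> z) = sets MY"
    using measurable_space[OF kappa assms] by (auto simp: space_prob_algebra)
  show "(\<lambda>y. (y, z)) \<in> \<kappa> z \<rightarrow>\<^sub>M MY \<Otimes>\<^sub>M MZ"
    using assms 2 by (intro measurable_Pair) (auto cong: measurable_cong_sets)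
qed

lemma bind_fiber_kernel: "\<omega> \<bind> fiber_kernel = \<pi>t"
proof (rule measure_eqI)
  note fk = measurable_prob_algebraD[OF fiber_kernel_measurable]
  have ne: "space \<omega> \<noteq> {}"
    using prob_space.not_empty[OF prob_omega] .
  show sets: "sets (\<omega> \<bind> fiber_kernel) = sets \<pi>t"
    using sets_bind[OF sets_kernel[OF fk] ne] sets_pit by simp
  fix A assume "A \<in> sets (\<omega> \<bind> fiber_kernel)"
  then have A: "A \<in> sets (MY \<Otimes>\<^sub>M MZ)"
    using sets sets_pit by simp
  have "emeasure (\<omega> \<bind> fiber_kernel) A = (\<integral>\<^sup>+z. emeasure (fiber_kernel z) A \<partial>\<omega>)"
    by (rule emeasure_bind[OF ne fk A])
  also have "\<dots> = (\<integral>\<^sup>+ z. \<integral>\<^sup>+ y. indicator A (y, z) \<partial>\<kappa> z \<partial>\<omega>)"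
  proof (intro nn_integral_cong)
    fix z assume "z \<in> space \<omega>"
    then have z: "z \<in> space MZ" by (simp add: space_omega)
    have "emeasure (fiber_kernel z) A = (\<integral>\<^sup>+p. indicator A p \<partial>fiber_kernel z)"
      using A by (simp add: fiber_kernel_def)
    also have "\<dots> = (\<integral>\<^sup>+ y. indicator A (y, z) \<partial>\<kappa> z)"
      unfolding fiber_kernel_def using A by (intro nn_integral_distr pair_measurable_kappa z) auto
    finally show "emeasure (fiber_kernel z) A = (\<integral>\<^sup>+ y. indicator A (y, z) \<partial>\<kappa> z)" .
  qed
  finally show "emeasure (\<omega> \<bind> fiber_kernel) A = emeasure \<pi>t A"
    by (simp add: disintegration[OF A])
qed

lemma nn_integral_fibers:
  assumes f: "f \<in> borel_measurable (MY \<Otimes>\<^sub>M MZ)"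
  shows "(\<integral>\<^sup>+p. f p \<partial>\<pi>t) = (\<integral>\<^sup>+z. \<integral>\<^sup>+y. f (y, z) \<partial>\<kappa> z \<partial>\<omega>)"
proof -
  have "(\<integral>\<^sup>+p. f p \<partial>\<pi>t) = (\<integral>\<^sup>+z. \<integral>\<^sup>+p. f p \<partial>fiber_kernel z \<partial>\<omega>)"
    unfolding bind_fiber_kernel[symmetric]
    by (rule nn_integral_bind[OF f measurable_prob_algebraD[OF fiber_kernel_measurable]])
  also have "\<dots> = (\<integral>\<^sup>+z. \<integral>\<^sup>+y. f (y, z) \<partial>\<kappa> z \<partial>\<omega>)"
    unfolding fiber_kernel_def
    by (intro nn_integral_cong nn_integral_distr pair_measurable_kappa) (simp_all add: space_omega f)
  finally show ?thesis .
qed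

text \<open>The set where \<open>P\<close> fails need not be measurable, so it is first enclosed in
  a measurable null set \<open>A\<close>, almost all of whose sections are null.\<close>

lemma AE_fibers:
  assumes "AE p in \<pi>t. P p"
  shows "AE z in \<omega>. AE y in \<kappa> z. P (y, z)"
proof -
  obtain A where A: "{p \<in> space \<pi>t. \<not> P p} \<subseteq> A" "emeasure \<pi>t A = 0" "A \<in> sets \<pi>t"
    using assms by (auto elim: AE_E)
  have "AE p in \<omega> \<bind> fiber_kernel. p \<notin> A"
    unfolding bind_fiber_kernel using A by (intro AE_not_in null_setsI)
  moreover have "Measurable.pred (MY \<Otimes>\<^sub>M MZ) (\<lambda>p. p \<notin> A)"
    using A(3) sets_pit by measurable
  ultimately have "AE z in \<omega>. AE p in fiber_kernel z. p \<notin> A"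
    by (simp add: AE_bind[OF measurable_prob_algebraD[OF fiber_kernel_measurable]])
  then show ?thesis
    using AE_space
  proof eventually_elim
    case (elim z)
    then have z: "z \<in> space MZ" by (simp add: space_omega)
    have "AE y in \<kappa> z. (y, z) \<notin> A"
      using elim(1) A(3) sets_pit unfolding fiber_kernel_def
      by (subst (asm) AE_distr_iff[OF pair_measurable_kappa[OF z]]) auto
    then show ?case
      using AE_space
    proof eventually_elim
      case (elim y)
      then have "(y, z) \<in> space \<pi>t"
        using z sets_eq_imp_space_eq[OF sets_pit] sets_eq_imp_space_eq[OF sets_kappa[OF z]]
        by (simp add: space_pair_measure)
      then show ?case
        using A(1) elim(1) by blast
    qed
  qed
qed

lemma fiber_avg_eq_kernel_op:
  assumes "h \<in> borel_measurable (MY \<Otimes>\<^sub>M MZ)" "z \<in> space MZ"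
  shows "fiber_avg \<kappa> h z = kernel_op fiber_kernel h z"
  unfolding fiber_avg_def kernel_op_def fiber_kernel_def
  using assms by (intro integral_distr[symmetric] pair_measurable_kappa)

context
  fixes h assumes h: "square_integrable \<pi>t h"
begin

lemma square_integrable_measurable_pair: "h \<in> borel_measurable (MY \<Otimes>\<^sub>M MZ)"
  using square_integrable_measurable[OF h] sets_pit by (simp cong: measurable_cong_sets)

lemma square_integrable_bind: "square_integrable (\<omega> \<bind> fiber_kernel) h"
  using h by (simp add: bind_fiber_kernel)

lemma square_integrable_fiber_avg: "square_integrable \<omega> (fiber_avg \<kappa> h)"
proof -
  have "square_integrable \<omega> (kernel_op fiber_kernel h)"
    by (rule square_integrable_kernel_op[OF prob_omega fiber_kernel_measurable square_integrable_bind])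
  then show ?thesis
    by (rule square_integrable_cong) (simp add: fiber_avg_eq_kernel_op[OF square_integrable_measurable_pair] space_omega)
qed

lemma integral_fiber_avg: "(\<integral>z. fiber_avg \<kappa> h z \<partial>\<omega>) = (\<integral>p. h p \<partial>\<pi>t)"
proof -
  have "(\<integral>z. fiber_avg \<kappa> h z \<partial>\<omega>) = (\<integral>z. kernel_op fiber_kernel h z \<partial>\<omega>)"
    by (intro Bochner_Integration.integral_cong refl)
      (simp add: fiber_avg_eq_kernel_op[OF square_integrable_measurable_pair] space_omega)
  then show ?thesis
    using integral_kernel_op[OF prob_omega fiber_kernel_measurable square_integrable_bind]
    by (simp add: bind_fiber_kernel)
qed

lemma AE_square_integrable_fiber: "AE z in \<omega>. square_integrable (\<kappa> z) (\<lambda>y. h (y, z))"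
  using AE_square_integrable_kernel[OF prob_omega fiber_kernel_measurable square_integrable_bind] AE_space
proof eventually_elim
  case (elim z)
  then have "z \<in> space MZ" by (simp add: space_omega)
  note pm = pair_measurable_kappa[OF this]
  have "(\<lambda>p. (h p)\<^sup>2) \<in> borel_measurable (MY \<Otimes>\<^sub>M MZ)"
    using square_integrable_measurable_pair by measurable
  from integrable_distr_eq[OF pm this] show ?case
    using elim(1) measurable_compose[OF pm square_integrable_measurable_pair]
    by (simp add: square_integrable_def fiber_kernel_def)
qed

text \<open>Law of total variance, minus the contribution of the overall mean on both sides. It is
  stated with a nonnegative integral because the bound that will be put on the fiber variances may
  have an infinite integral.\<close>

lemma nn_integral_fiber_variance:
  "(\<integral>\<^sup>+z. ennreal (\<integral>y. (h (y, z) - fiber_avg \<kappa> h z)\<^sup>2 \<partial>\<kappa> z) \<partial>\<omega>) =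
     ennreal ((\<integral>p. (h p)\<^sup>2 \<partial>\<pi>t) - (\<integral>z. (fiber_avg \<kappa> h z)\<^sup>2 \<partial>\<omega>))"
proof -
  let ?V = "\<lambda>z. fiber_avg \<kappa> (\<lambda>p. (h p)\<^sup>2) z - (fiber_avg \<kappa> h z)\<^sup>2"
  note KO = prob_omega fiber_kernel_measurable square_integrable_bind
  have sq_meas: "(\<lambda>p. (h p)\<^sup>2) \<in> borel_measurable (MY \<Otimes>\<^sub>M MZ)"
    using square_integrable_measurable_pair by measurable
  have I: "integrable \<omega> (fiber_avg \<kappa> (\<lambda>p. (h p)\<^sup>2))"
    "(\<integral>z. fiber_avg \<kappa> (\<lambda>p. (h p)\<^sup>2) z \<partial>\<omega>) = (\<integral>p. (h p)\<^sup>2 \<partial>\<pi>t)"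
  proof -
    let ?F = "fiber_avg \<kappa> (\<lambda>p. (h p)\<^sup>2)" and ?G = "kernel_op fiber_kernel (\<lambda>p. (h p)\<^sup>2)"
    have eq: "fiber_avg \<kappa> (\<lambda>p. (h p)\<^sup>2) z = kernel_op fiber_kernel (\<lambda>p. (h p)\<^sup>2) z"
      if "z \<in> space \<omega>" for z
      using that by (simp add: fiber_avg_eq_kernel_op[OF sq_meas] space_omega)
    show "integrable \<omega> (fiber_avg \<kappa> (\<lambda>p. (h p)\<^sup>2))"
      using integrable_kernel_op_square[OF KO] Bochner_Integration.integrable_cong[of \<omega> \<omega> ?F ?G, OF refl eq] by simp
    show "(\<integral>z. fiber_avg \<kappa> (\<lambda>p. (h p)\<^sup>2) z \<partial>\<omega>) = (\<integral>p. (h p)\<^sup>2 \<partial>\<pi>t)"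
      using integral_kernel_op_square[OF KO] Bochner_Integration.integral_cong[of \<omega> \<omega> ?F ?G, OF refl eq]
      by (simp add: bind_fiber_kernel)
  qed
  note I' = square_integrable_integrable_square[OF square_integrable_fiber_avg]
  have AE: "AE z in \<omega>. (\<integral>y. (h (y, z) - fiber_avg \<kappa> h z)\<^sup>2 \<partial>\<kappa> z) = ?V z"
    using AE_square_integrable_fiber AE_space
  proof eventually_elim
    case (elim z)
    then interpret k: prob_space "\<kappa> z" by (intro prob_kappa) (simp add: space_omega)
    show ?case
      using k.variance_eq[OF k.square_integrable_integrable[OF elim(1)]
          square_integrable_integrable_square[OF elim(1)]]
      by (simp add: fiber_avg_def)
  qed
  have nonneg: "AE z in \<omega>. 0 \<le> ?V z"
    using AE by eventually_elim (metis Bochner_Integration.integral_nonneg zero_le_power2)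
  have "(\<integral>\<^sup>+z. ennreal (\<integral>y. (h (y, z) - fiber_avg \<kappa> h z)\<^sup>2 \<partial>\<kappa> z) \<partial>\<omega>) = (\<integral>\<^sup>+z. ennreal (?V z) \<partial>\<omega>)"
    using AE by (intro nn_integral_cong_AE) auto
  also have "\<dots> = ennreal (\<integral>z. ?V z \<partial>\<omega>)"
    using I I' nonneg by (intro nn_integral_eq_integral) auto
  finally show ?thesis
    using I I' by simp
qed

end

lemma fiber_avg_L02: "h \<in> L02 \<pi>t \<Longrightarrow> fiber_avg \<kappa> h \<in> L02 \<omega>"
  using square_integrable_fiber_avg[of h] integral_fiber_avg[of h] by (simp add: L02_iff)

lemma fiber_lift_eq: "fiber_lift g = (\<lambda>p. g (snd p))"
  by (auto simp: fiber_lift_def)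

lemma square_integrable_fiber_lift: "square_integrable \<omega> g \<Longrightarrow> square_integrable \<pi>t (fiber_lift g)"
  using measurable_compose[OF snd_measurable_pit, of g borel]
  by (auto simp: square_integrable_def fiber_lift_eq omega integrable_distr_eq[OF snd_measurable_pit])

lemma fiber_lift_L02: "g \<in> L02 \<omega> \<Longrightarrow> fiber_lift g \<in> L02 \<pi>t"
  using square_integrable_fiber_lift[of g]
  by (auto simp: L02_iff fiber_lift_eq omega integral_distr[OF snd_measurable_pit] square_integrable_def)

text \<open>The lifted function is constant along each fiber and comes out of the inner
  integral.\<close>

lemma L2_inner_fiber_lift:
  assumes h: "square_integrable \<pi>t h" and g: "square_integrable \<omega> g"
  shows "L2_inner \<pi>t h (fiber_lift g) = L2_inner \<omega> (fiber_avg \<kappa> h) g"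
proof -
  note hm = square_integrable_measurable_pair[OF h]
  have "g \<in> borel_measurable MZ"
    using square_integrable_measurable[OF g] sets_omega by (simp cong: measurable_cong_sets)
  then have m: "(\<lambda>p. h p * fiber_lift g p) \<in> borel_measurable (MY \<Otimes>\<^sub>M MZ)"
    unfolding fiber_lift_eq using hm by measurable
  have "integrable (\<omega> \<bind> fiber_kernel) (\<lambda>p. h p * fiber_lift g p)"
    unfolding bind_fiber_kernel by (rule square_integrable_mult[OF h square_integrable_fiber_lift[OF g]])
  then have "L2_inner \<pi>t h (fiber_lift g) = (\<integral>z. kernel_op fiber_kernel (\<lambda>p. h p * fiber_lift g p) z \<partial>\<omega>)"
    using integral_bind_kernel(3)[OF measurable_prob_algebraD[OF fiber_kernel_measurable]
        prob_space.not_empty[OF prob_omega]]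
    by (simp add: L2_inner_def kernel_op_def bind_fiber_kernel)
  also have "\<dots> = (\<integral>z. fiber_avg \<kappa> h z * g z \<partial>\<omega>)"
    by (intro Bochner_Integration.integral_cong)
      (simp_all add: fiber_avg_eq_kernel_op[OF m, symmetric] space_omega, simp add: fiber_avg_def fiber_lift_def)
  finally show ?thesis
    by (simp add: L2_inner_def)
qed

section \<open>Fiberwise kernels against the kernel on the product\<close>

lemma fiber_kernels_measurable:
  assumes Qz_kernel: "\<And>z. z \<in> space MZ \<Longrightarrow> Qz z \<in> MY \<rightarrow>\<^sub>M prob_algebra MY"
    and Qz_measurable: "\<And>B. B \<in> sets MY \<Longrightarrow>
          (\<lambda>(y, z). measure (Qz z y) B) \<in> borel_measurable (MY \<Otimes>\<^sub>M MZ)"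
  shows "(\<lambda>(y, z). Qz z y) \<in> MY \<Otimes>\<^sub>M MZ \<rightarrow>\<^sub>M subprob_algebra MY"
proof (rule measurable_subprob_algebra)
  have Qz: "prob_space (Qz (snd p) (fst p))" "sets (Qz (snd p) (fst p)) = sets MY"
    if "p \<in> space (MY \<Otimes>\<^sub>M MZ)" for p
    using measurable_space[OF Qz_kernel, of "snd p" "fst p"] that
    by (auto simp: space_pair_measure space_prob_algebra)
  fix p assume p: "p \<in> space (MY \<Otimes>\<^sub>M MZ)"
  show "subprob_space (case p of (y, z) \<Rightarrow> Qz z y)" "sets (case p of (y, z) \<Rightarrow> Qz z y) = sets MY"
    using Qz[OF p] by (auto simp: case_prod_beta prob_space_imp_subprob_space)
next
  fix B assume B: "B \<in> sets MY"
  have "(\<lambda>p. ennreal (case p of (y, z) \<Rightarrow> measure (Qz z y) B)) \<in> borel_measurable (MY \<Otimes>\<^sub>M MZ)"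
    using Qz_measurable[OF B] by simp
  moreover have "emeasure (case p of (y, z) \<Rightarrow> Qz z y) B = ennreal (case p of (y, z) \<Rightarrow> measure (Qz z y) B)"
    if "p \<in> space (MY \<Otimes>\<^sub>M MZ)" for p
  proof -
    have "prob_space (Qz (snd p) (fst p))"
      using measurable_space[OF Qz_kernel, of "snd p" "fst p"] that
      by (auto simp: space_pair_measure space_prob_algebra)
    then show ?thesis
      by (simp add: case_prod_beta finite_measure.emeasure_eq_measure prob_space.finite_measure)
  qed
  ultimately show "(\<lambda>p. emeasure (case p of (y, z) \<Rightarrow> Qz z y) B) \<in> borel_measurable (MY \<Otimes>\<^sub>M MZ)"
    by (subst measurable_cong) auto
qed

text \<open>The left side is the mean of the fiber variances. Each is bounded by the weak Poincare
  inequality of its fiber, and the fiber Dirichlet forms are averaged through their double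
  integrals, where the lower bound on \<open>Q\<close> costs the factor 1/c.\<close>

lemma fiber_poincare:
  fixes a :: "'z \<Rightarrow> real"
  assumes Q: "Q \<in> \<pi>t \<rightarrow>\<^sub>M prob_algebra \<pi>t" "\<pi>t \<bind> Q = \<pi>t"
    and singletons: "\<And>y. y \<in> space MY \<Longrightarrow> {y} \<in> sets MY" "\<And>z. z \<in> space MZ \<Longrightarrow> {z} \<in> sets MZ"
    and Qz_kernel: "\<And>z. z \<in> space MZ \<Longrightarrow> Qz z \<in> MY \<rightarrow>\<^sub>M prob_algebra MY"
    and Qz_reversible: "AE z in \<omega>. reversible_kernel (\<kappa> z) (Qz z)"
    and Qz_measurable: "\<And>B. B \<in> sets MY \<Longrightarrow>
          (\<lambda>(y, z). measure (Qz z y) B) \<in> borel_measurable (MY \<Otimes>\<^sub>M MZ)"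
    and c: "0 < c"
    and Q_ge: "AE (y, z) in \<pi>t. \<forall>B\<in>sets MY.
          measure (Q (y, z)) ((B - {y}) \<times> {z}) \<ge> c * measure (Qz z y) (B - {y})"
    and u: "0 < u" and a: "a \<in> borel_measurable MZ" "\<And>z. z \<in> space MZ \<Longrightarrow> 0 \<le> a z"
    and poincare: "AE z in \<omega>. \<forall>g\<in>L02 (\<kappa> z).
          ereal ((L2_norm (\<kappa> z) g)\<^sup>2) \<le>
            ereal (u * dirichlet_form (\<kappa> z) (kernel_op (Qz z)) g)
            + ereal (a z) * (osc_norm (\<kappa> z) g)\<^sup>2"
    and h: "square_integrable \<pi>t h" and osc: "AE p in \<pi>t. m \<le> h p \<and> h p \<le> m + D"
  shows "ennreal ((\<integral>p. (h p)\<^sup>2 \<partial>\<pi>t) - (\<integral>z. (fiber_avg \<kappa> h z)\<^sup>2 \<partial>\<omega>))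
    \<le> ennreal (u / c * dirichlet_form \<pi>t (kernel_op Q) h) + (\<integral>\<^sup>+z. ennreal (a z) \<partial>\<omega>) * ennreal (D\<^sup>2)"
proof -
  note [measurable] = square_integrable_measurable_pair[OF h]
  \<comment> \<open>Energy of the jumps from \<open>p\<close> inside its fiber. It is an extended
    nonnegative function on the whole product, jointly measurable, so it can be integrated against
    \<open>\<pi>t\<close> directly or fiber by fiber.\<close>
  define G where "G p = (\<integral>\<^sup>+y'. ennreal ((h p - h (y', snd p))\<^sup>2) \<partial>Qz (snd p) (fst p))" for p
  have L: "(\<lambda>p. Qz (snd p) (fst p)) \<in> MY \<Otimes>\<^sub>M MZ \<rightarrow>\<^sub>M subprob_algebra MY"
    using fiber_kernels_measurable[OF Qz_kernel Qz_measurable] by (simp add: case_prod_beta)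
  have G: "G \<in> borel_measurable (MY \<Otimes>\<^sub>M MZ)"
    unfolding G_def
  proof (rule nn_integral_measurable_subprob_algebra2[OF _ L])
    have "(\<lambda>q. ennreal ((h (fst q) - h (snd q, snd (fst q)))\<^sup>2)) \<in> borel_measurable ((MY \<Otimes>\<^sub>M MZ) \<Otimes>\<^sub>M MY)"
      by measurable
    then show "(\<lambda>(p, y'). ennreal ((h p - h (y', snd p))\<^sup>2)) \<in> borel_measurable ((MY \<Otimes>\<^sub>M MZ) \<Otimes>\<^sub>M MY)"
      by (simp add: case_prod_beta)
  qed
  note spt = sets_eq_imp_space_eq[OF sets_pit]
  \<comment> \<open>The slice comparison for the squared difference from \<open>h p\<close>, which
    vanishes at \<open>p\<close> as required there.\<close>
  have "AE p in \<pi>t. ennreal c * G p \<le> (\<integral>\<^sup>+q. ennreal ((h p - h q)\<^sup>2) \<partial>Q p)"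
    using Q_ge AE_space
  proof eventually_elim
    case (elim p)
    obtain y z where p: "p = (y, z)" by (cases p)
    have yz: "y \<in> space MY" "z \<in> space MZ"
      using elim(2) p spt by (auto simp: space_pair_measure)
    have Qp: "prob_space (Q p)" "sets (Q p) = sets (MY \<Otimes>\<^sub>M MZ)"
      using measurable_space[OF Q(1) elim(2)] sets_pit by (auto simp: space_prob_algebra)
    have Qzy: "prob_space (Qz z y)" "sets (Qz z y) = sets MY"
      using measurable_space[OF Qz_kernel[OF yz(2)] yz(1)] by (auto simp: space_prob_algebra)
    show ?case
      unfolding G_def p fst_conv snd_conv
    proof (rule nn_integral_slice_le[OF _ Qzy(2) _ Qp(2)[unfolded p] singletons(1)[OF yz(1)]
          singletons(2)[OF yz(2)]])
      show "(\<lambda>q. ennreal ((h (y, z) - h q)\<^sup>2)) \<in> borel_measurable (MY \<Otimes>\<^sub>M MZ)"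
        by measurable
    qed (use elim(1) p c Qp Qzy in \<open>auto intro: prob_space.finite_measure\<close>)
  qed
  then have "(\<integral>\<^sup>+p. ennreal c * G p \<partial>\<pi>t) \<le> (\<integral>\<^sup>+p. \<integral>\<^sup>+q. ennreal ((h p - h q)\<^sup>2) \<partial>Q p \<partial>\<pi>t)"
    by (rule nn_integral_mono_AE)
  also have "\<dots> = ennreal (2 * dirichlet_form \<pi>t (kernel_op Q) h)"
    by (rule dirichlet_form_eq_double_integral(2)[OF prob_pit Q h])
  also have "(\<integral>\<^sup>+p. ennreal c * G p \<partial>\<pi>t) = ennreal c * (\<integral>\<^sup>+p. G p \<partial>\<pi>t)"
    using G sets_pit by (intro nn_integral_cmult) (simp cong: measurable_cong_sets)
  finally have G_le: "ennreal c * (\<integral>\<^sup>+p. G p \<partial>\<pi>t) \<le> ennreal (2 * dirichlet_form \<pi>t (kernel_op Q) h)" .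
  \<comment> \<open>The 1/2 compensates for the double integral being twice the Dirichlet form.
    Dividing by \<open>c\<close> needs a finite integral of \<open>G\<close>; an infinite one would
    contradict the real bound in \<open>G_le\<close>.\<close>
  have G_le': "ennreal (u / 2) * (\<integral>\<^sup>+p. G p \<partial>\<pi>t) \<le> ennreal (u / c * dirichlet_form \<pi>t (kernel_op Q) h)"
  proof (cases "\<integral>\<^sup>+p. G p \<partial>\<pi>t")
    case (real r)
    have E: "0 \<le> dirichlet_form \<pi>t (kernel_op Q) h"
      by (rule dirichlet_form_eq_double_integral(1)[OF prob_pit Q h])
    have "c * r \<le> 2 * dirichlet_form \<pi>t (kernel_op Q) h"
      using G_le real c E by (simp add: ennreal_mult[symmetric])
    then have "u / (2 * c) * (c * r) \<le> u / (2 * c) * (2 * dirichlet_form \<pi>t (kernel_op Q) h)"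
      using u c by (intro mult_left_mono) auto
    then show ?thesis
      using real u c by (simp add: ennreal_mult[symmetric] ennreal_leI)
  next
    case top
    then show ?thesis
      using G_le c by (simp add: ennreal_mult_top top_unique)
  qed
  let ?V = "\<lambda>z. \<integral>y. (h (y, z) - fiber_avg \<kappa> h z)\<^sup>2 \<partial>\<kappa> z"
  have "AE z in \<omega>. ennreal (?V z) \<le> ennreal (u / 2) * (\<integral>\<^sup>+y. G (y, z) \<partial>\<kappa> z) + ennreal (a z) * ennreal (D\<^sup>2)"
    using Qz_reversible poincare AE_square_integrable_fiber[OF h] AE_fibers[OF osc] AE_space
  proof eventually_elim
    case (elim z)
    then have z: "z \<in> space MZ" by (simp add: space_omega)
    interpret k: prob_space "\<kappa> z" by (rule prob_kappa[OF z])
    \<comment> \<open>The fiber inequality applies to functions centered on the fiber. Subtracting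
      the fiber mean changes neither the differences entering \<open>G\<close> nor the length of the
      interval containing the values.\<close>
    define g where "g y = h (y, z) - fiber_avg \<kappa> h z" for y
    have g_sq: "square_integrable (\<kappa> z) g"
      unfolding g_def by (rule square_integrable_diff[OF elim(3) k.square_integrable_const])
    have g: "g \<in> L02 (\<kappa> z)"
      using g_sq k.square_integrable_integrable[OF elim(3)]
      by (simp add: L02_iff g_def[abs_def] fiber_avg_def k.prob_space)
    have Qz: "Qz z \<in> \<kappa> z \<rightarrow>\<^sub>M prob_algebra (\<kappa> z)" "\<kappa> z \<bind> Qz z = \<kappa> z"
      using elim(1) by (auto simp: reversible_kernel_def)
    note E = dirichlet_form_eq_double_integral[OF prob_kappa[OF z] Qz g_sq]
    let ?E = "dirichlet_form (\<kappa> z) (kernel_op (Qz z)) g"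
    have GE: "(\<integral>\<^sup>+y. G (y, z) \<partial>\<kappa> z) = ennreal (2 * ?E)"
      unfolding E(2)[symmetric] by (simp add: G_def g_def)
    have AE_g: "AE y in \<kappa> z. m - fiber_avg \<kappa> h z \<le> g y \<and> g y \<le> m - fiber_avg \<kappa> h z + D"
      using elim(4) by eventually_elim (auto simp: g_def)
    have osc_g: "osc_norm (\<kappa> z) g \<le> ereal D"
      by (rule osc_norm_leI[OF square_integrable_measurable[OF g_sq] AE_g])
    have osc_g0: "0 \<le> osc_norm (\<kappa> z) g"
      by (rule osc_norm_nonneg[OF prob_kappa[OF z]])
    obtain d where d: "osc_norm (\<kappa> z) g = ereal d" "0 \<le> d" "d \<le> D"
      using osc_g osc_g0 by (cases "osc_norm (\<kappa> z) g") auto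
    have "?V z \<le> u * ?E + a z * d\<^sup>2"
      using bspec[OF elim(2) g] by (simp add: d(1) L2_norm_square g_def)
    also have "\<dots> \<le> u / 2 * (2 * ?E) + a z * D\<^sup>2"
      using d a(2)[OF z] by (intro add_mono mult_left_mono power_mono) auto
    finally have "ennreal (?V z) \<le> ennreal (u / 2 * (2 * ?E) + a z * D\<^sup>2)"
      by (rule ennreal_leI)
    also have "\<dots> = ennreal (u / 2) * ennreal (2 * ?E) + ennreal (a z) * ennreal (D\<^sup>2)"
      using u E(1) a(2)[OF z] by (simp add: ennreal_plus ennreal_mult[symmetric] del: ennreal_plus[symmetric])
    finally show ?case
      unfolding GE .
  qed
  then have "(\<integral>\<^sup>+z. ennreal (?V z) \<partial>\<omega>)
    \<le> (\<integral>\<^sup>+z. ennreal (u / 2) * (\<integral>\<^sup>+y. G (y, z) \<partial>\<kappa> z) + ennreal (a z) * ennreal (D\<^sup>2) \<partial>\<omega>)"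
    by (rule nn_integral_mono_AE)
  also have "\<dots> = ennreal (u / 2) * (\<integral>\<^sup>+z. \<integral>\<^sup>+y. G (y, z) \<partial>\<kappa> z \<partial>\<omega>) + (\<integral>\<^sup>+z. ennreal (a z) \<partial>\<omega>) * ennreal (D\<^sup>2)"
  proof -
    have 1: "(\<lambda>z. \<integral>\<^sup>+y. G (y, z) \<partial>\<kappa> z) \<in> borel_measurable \<omega>"
    proof -
      have "(\<lambda>z. \<integral>\<^sup>+y. G (y, z) \<partial>\<kappa> z) \<in> borel_measurable MZ"
        using measurable_compose[OF measurable_Pair[OF measurable_snd measurable_fst] G]
        by (intro nn_integral_measurable_subprob_algebra2[OF _ measurable_prob_algebraD[OF kappa]])
          (simp add: case_prod_beta)
      then show ?thesis
        using sets_omega by (simp cong: measurable_cong_sets)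
    qed
    have 2: "(\<lambda>z. ennreal (a z)) \<in> borel_measurable \<omega>"
      using a(1) sets_omega by (simp cong: measurable_cong_sets)
    show ?thesis
      using 1 2 by (simp add: nn_integral_add nn_integral_cmult nn_integral_multc)
  qed
  also have "(\<integral>\<^sup>+z. \<integral>\<^sup>+y. G (y, z) \<partial>\<kappa> z \<partial>\<omega>) = (\<integral>\<^sup>+p. G p \<partial>\<pi>t)"
    by (rule nn_integral_fibers[OF G, symmetric])
  finally show ?thesis
    unfolding nn_integral_fiber_variance[OF h] using G_le'
    by (meson add_right_mono order_trans)
qed

end

subsection \<open>The rate function\<close>

lemma beta_tilde_le:
  assumes "1 \<le> u" "u\<^sub>1 * u\<^sub>2 = c * u" "0 < u\<^sub>1" "1 < u\<^sub>2"
  shows "beta_tilde c \<beta> ab u \<le> ereal (\<beta> u\<^sub>1) + ereal u\<^sub>1 * ab u\<^sub>2"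
  unfolding beta_tilde_def using assms by (auto intro!: Inf_lower)

lemma beta_tilde_greatest:
  assumes "1 \<le> u"
    and "\<And>u\<^sub>1 u\<^sub>2. u\<^sub>1 * u\<^sub>2 = c * u \<Longrightarrow> 0 < u\<^sub>1 \<Longrightarrow> 1 < u\<^sub>2 \<Longrightarrow> b \<le> ereal (\<beta> u\<^sub>1) + ereal u\<^sub>1 * ab u\<^sub>2"
  shows "b \<le> beta_tilde c \<beta> ab u"
  unfolding beta_tilde_def using assms by (auto intro!: Inf_greatest)

lemma beta_tilde_lt_1:
  "u < 1 \<Longrightarrow> beta_tilde c \<beta> ab u = max (ereal (1/4)) (ereal (\<beta> c) + ab 1)"
  by (simp add: beta_tilde_def)

locale beta_rate =
  fixes c :: real and \<beta> :: "real \<Rightarrow> real" and ab :: "real \<Rightarrow> ereal"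
  assumes c: "0 < c" "c \<le> 1"
    and beta_nonneg: "\<And>u. 0 < u \<Longrightarrow> 0 \<le> \<beta> u"
    and ab_nonneg: "\<And>u. 0 < u \<Longrightarrow> 0 \<le> ab u"
begin

lemma beta_tilde_nonneg: "0 \<le> beta_tilde c \<beta> ab u"
proof (cases "u < 1")
  case True
  have "(0::ereal) \<le> ereal (1/4)" by simp
  then show ?thesis
    unfolding beta_tilde_lt_1[OF True] by (rule order_trans) simp
next
  case False
  then show ?thesis
    using beta_nonneg ab_nonneg by (intro beta_tilde_greatest) auto
qed

context
  assumes ab_mono: "antimono_on {0<..} ab"
begin

lemma ab_le: "0 < u \<Longrightarrow> u \<le> v \<Longrightarrow> ab v \<le> ab u"
  using ab_mono by (auto simp: monotone_on_def)

text \<open>An admissible pair for \<open>u\<close> becomes one for \<open>v\<close> by scaling its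
  second entry by v / u; this entry only grows, so it stays above 1 and the value of
  \<open>ab\<close> does not increase.\<close>

lemma beta_tilde_antimono_ge_1: "antimono_on {1..} (beta_tilde c \<beta> ab)"
proof (rule monotone_onI)
  fix u v :: real assume "u \<in> {1..}" and "v \<in> {1..}" and uv: "u \<le> v"
  then have u: "1 \<le> u" and v: "1 \<le> v" by auto
  show "beta_tilde c \<beta> ab v \<le> beta_tilde c \<beta> ab u"
  proof (rule beta_tilde_greatest[OF u])
    fix u\<^sub>1 u\<^sub>2 assume *: "u\<^sub>1 * u\<^sub>2 = c * u" "0 < u\<^sub>1" "1 < u\<^sub>2"
    have le: "u\<^sub>2 \<le> u\<^sub>2 * (v / u)"
      using mult_left_mono[of 1 "v / u" u\<^sub>2] * u uv by simp
    have "u\<^sub>1 * (u\<^sub>2 * (v / u)) = c * v"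
      using *(1) u by (simp add: field_simps)
    then have "beta_tilde c \<beta> ab v \<le> ereal (\<beta> u\<^sub>1) + ereal u\<^sub>1 * ab (u\<^sub>2 * (v / u))"
      using * v le by (intro beta_tilde_le) auto
    also have "\<dots> \<le> ereal (\<beta> u\<^sub>1) + ereal u\<^sub>1 * ab u\<^sub>2"
      using * le by (intro add_left_mono ereal_mult_left_mono ab_le) auto
    finally show "beta_tilde c \<beta> ab v \<le> ereal (\<beta> u\<^sub>1) + ereal u\<^sub>1 * ab u\<^sub>2" .
  qed
qed

text \<open>The pair of \<open>c\<close> and \<open>v\<close> is admissible, precisely because v >
  1, and c \<le> 1 absorbs the factor in front of \<open>ab v\<close>.\<close>

lemma beta_tilde_le_lt_1:
  assumes "u < 1" "1 < v"
  shows "beta_tilde c \<beta> ab v \<le> beta_tilde c \<beta> ab u"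
proof -
  have "beta_tilde c \<beta> ab v \<le> ereal (\<beta> c) + ereal c * ab v"
    using assms c by (intro beta_tilde_le) auto
  also have "\<dots> \<le> ereal (\<beta> c) + 1 * ab 1"
    using assms c ab_nonneg[of v] by (intro add_left_mono ereal_mult_mono ab_le) auto
  also have "\<dots> \<le> beta_tilde c \<beta> ab u"
    by (simp add: beta_tilde_lt_1[OF assms(1)])
  finally show ?thesis .
qed

lemma beta_tilde_antimono_except_1: "antimono_on ({0<..} - {1}) (beta_tilde c \<beta> ab)"
proof (rule monotone_onI)
  fix u v :: real assume *: "u \<in> {0<..} - {1}" "v \<in> {0<..} - {1}" "u \<le> v"
  consider "v < 1" | "u < 1" "1 < v" | "1 < u"
    using * by fastforce
  then show "beta_tilde c \<beta> ab v \<le> beta_tilde c \<beta> ab u"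
  proof cases
    case 1
    then show ?thesis using * by (simp add: beta_tilde_lt_1)
  next
    case 2
    then show ?thesis by (rule beta_tilde_le_lt_1)
  next
    case 3
    then show ?thesis using beta_tilde_antimono_ge_1 * by (auto simp: monotone_on_def)
  qed
qed

text \<open>At 1 the pair of \<open>c\<close> and 1 is not admissible, but it is approached by pairs
  of \<open>u\<^sub>1\<close> and \<open>c / u\<^sub>1\<close> with the first entry increasing to
  \<open>c\<close>; left continuity lets \<beta> follow.\<close>

lemma beta_tilde_antimono:
  assumes left: "(\<beta> \<longlongrightarrow> \<beta> c) (at_left c)"
  shows "antimono_on {0<..} (beta_tilde c \<beta> ab)"
proof -
  have 1: "beta_tilde c \<beta> ab 1 \<le> ereal (\<beta> c) + ab 1"
  proof (rule tendsto_lowerbound)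
    show "((\<lambda>u\<^sub>1. ereal (\<beta> u\<^sub>1) + ab 1) \<longlongrightarrow> ereal (\<beta> c) + ab 1) (at_left c)"
      using ab_nonneg[of 1] left by (intro tendsto_add_ereal_general) auto
    show "\<forall>\<^sub>F u\<^sub>1 in at_left c. beta_tilde c \<beta> ab 1 \<le> ereal (\<beta> u\<^sub>1) + ab 1"
      using eventually_at_left_real[OF c(1)]
    proof eventually_elim
      case (elim u\<^sub>1)
      then have u\<^sub>1: "0 < u\<^sub>1" "u\<^sub>1 < c" "1 < c / u\<^sub>1" by auto
      then have "beta_tilde c \<beta> ab 1 \<le> ereal (\<beta> u\<^sub>1) + ereal u\<^sub>1 * ab (c / u\<^sub>1)"
        by (intro beta_tilde_le) auto
      also have "\<dots> \<le> ereal (\<beta> u\<^sub>1) + 1 * ab 1"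
        using u\<^sub>1 c ab_nonneg[of "c / u\<^sub>1"] by (intro add_left_mono ereal_mult_mono ab_le) auto
      finally show ?case by simp
    qed
  qed simp
  show ?thesis
  proof (rule monotone_onI)
    fix u v :: real assume *: "u \<in> {0<..}" "v \<in> {0<..}" "u \<le> v"
    consider "u < 1" "v = 1" | "1 \<le> u" | "u \<noteq> 1" "v \<noteq> 1"
      using * by fastforce
    then show "beta_tilde c \<beta> ab v \<le> beta_tilde c \<beta> ab u"
    proof cases
      case 1
      then show ?thesis
        using \<open>beta_tilde c \<beta> ab 1 \<le> ereal (\<beta> c) + ab 1\<close>
        by (auto simp: beta_tilde_lt_1 intro: order_trans max.cobounded2)
    next
      case 2
      then show ?thesis using beta_tilde_antimono_ge_1 * by (auto simp: monotone_on_def)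
    next
      case 3
      then show ?thesis using beta_tilde_antimono_except_1 * by (auto simp: monotone_on_def)
    qed
  qed
qed

text \<open>Fix the first entry of the pair so that \<beta> is small there. The second entry then
  grows linearly with \<open>u\<close>, so the \<open>ab\<close> term, whose prefactor is now
  constant, tends to 0.\<close>

lemma beta_tilde_tendsto_0:
  assumes beta_lim: "(\<beta> \<longlongrightarrow> 0) at_top" and ab_lim: "(ab \<longlongrightarrow> 0) at_top"
  shows "(beta_tilde c \<beta> ab \<longlongrightarrow> 0) at_top"
proof (rule order_tendstoI)
  fix a :: ereal assume "a < 0"
  then show "\<forall>\<^sub>F u in at_top. a < beta_tilde c \<beta> ab u"
    using beta_tilde_nonneg less_le_trans by (intro always_eventually allI) blast
next
  fix a :: ereal assume "0 < a"
  then obtain e where e: "0 < e" "ereal e < a"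
    using ereal_dense2[of 0 a] by (auto simp: zero_ereal_def)
  have "\<forall>\<^sub>F u in at_top. \<beta> u < e / 2"
    using order_tendstoD(2)[OF beta_lim, of "e / 2"] e by simp
  then have "\<forall>\<^sub>F u in at_top. \<beta> u < e / 2 \<and> 0 < u"
    using eventually_gt_at_top[of 0] by eventually_elim simp
  then obtain u\<^sub>1 where u\<^sub>1: "\<beta> u\<^sub>1 < e / 2" "0 < u\<^sub>1"
    using eventually_happens[of _ at_top] by force
  have "\<forall>\<^sub>F u in at_top. ab u < ereal (e / 2 / u\<^sub>1)"
    using order_tendstoD(2)[OF ab_lim, of "ereal (e / 2 / u\<^sub>1)"] e u\<^sub>1 by simp
  moreover have "filterlim (\<lambda>u. c / u\<^sub>1 * u) at_top at_top"
    using c u\<^sub>1 by (intro filterlim_tendsto_pos_mult_at_top[OF tendsto_const _ filterlim_ident]) simp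
  ultimately have "\<forall>\<^sub>F u in at_top. ab (c / u\<^sub>1 * u) < ereal (e / 2 / u\<^sub>1)"
    by (rule eventually_compose_filterlim)
  moreover have "\<forall>\<^sub>F u in at_top. 1 < c / u\<^sub>1 * u"
    using eventually_gt_at_top[of "u\<^sub>1 / c"] by eventually_elim (use c u\<^sub>1 in \<open>simp add: field_simps\<close>)
  ultimately show "\<forall>\<^sub>F u in at_top. beta_tilde c \<beta> ab u < a"
    using eventually_ge_at_top[of 1]
  proof eventually_elim
    case (elim u)
    have "beta_tilde c \<beta> ab u \<le> ereal (\<beta> u\<^sub>1) + ereal u\<^sub>1 * ab (c / u\<^sub>1 * u)"
      using elim u\<^sub>1 by (intro beta_tilde_le) auto
    also have "\<dots> \<le> ereal (e / 2) + ereal u\<^sub>1 * ereal (e / 2 / u\<^sub>1)"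
      using elim u\<^sub>1 by (intro add_mono ereal_mult_left_mono) auto
    also have "\<dots> = ereal e"
      using u\<^sub>1 by simp
    finally show ?case
      using e(2) by simp
  qed
qed

end

end

text \<open>Passing to the infimum inside a product in \<open>ereal\<close> is avoided by solving
  each inequality for its rate, which needs \<open>D\<close> nonzero. For D = 0 the variance bound
  already makes \<open>X\<close> nonpositive, and for u < 1 it gives the claim through the entry 1/4
  of the maximum.\<close>

lemma (in beta_rate) weak_poincare_beta_tilde:
  assumes u: "0 < u" and E: "0 \<le> E" and var: "X \<le> D\<^sup>2 / 4"
    and pairs: "\<And>u\<^sub>1 u\<^sub>2. u\<^sub>1 * u\<^sub>2 = c * u \<Longrightarrow> 0 < u\<^sub>1 \<Longrightarrow> 1 < u\<^sub>2 \<Longrightarrow>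
      ereal X \<le> ereal (u * E) + (ereal (\<beta> u\<^sub>1) + ereal u\<^sub>1 * ab u\<^sub>2) * ereal (D\<^sup>2)"
  shows "ereal X \<le> ereal (u * E) + beta_tilde c \<beta> ab u * ereal (D\<^sup>2)"
proof -
  have uE: "0 \<le> u * E"
    using u E by simp
  consider "u < 1" | "1 \<le> u" "D = 0" | "1 \<le> u" "D \<noteq> 0"
    by linarith
  then show ?thesis
  proof cases
    case 1
    have "ereal X \<le> ereal (1/4) * ereal (D\<^sup>2)"
      using var by simp
    also have "\<dots> \<le> beta_tilde c \<beta> ab u * ereal (D\<^sup>2)"
      unfolding beta_tilde_lt_1[OF 1] by (intro ereal_mult_right_mono) auto
    finally show ?thesis
      using uE by (intro add_increasing) auto
  next
    case 2
    then show ?thesis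
      using var uE by (simp add: zero_ereal_def[symmetric])
  next
    case 3
    then have D: "0 < D\<^sup>2"
      by simp
    have "ereal ((X - u * E) / D\<^sup>2) \<le> beta_tilde c \<beta> ab u"
    proof (rule beta_tilde_greatest[OF 3(1)])
      fix u\<^sub>1 u\<^sub>2 assume *: "u\<^sub>1 * u\<^sub>2 = c * u" "0 < u\<^sub>1" "1 < u\<^sub>2"
      have "0 \<le> ereal (\<beta> u\<^sub>1) + ereal u\<^sub>1 * ab u\<^sub>2"
        using * beta_nonneg[of u\<^sub>1] ab_nonneg[of u\<^sub>2] by simp
      then show "ereal ((X - u * E) / D\<^sup>2) \<le> ereal (\<beta> u\<^sub>1) + ereal u\<^sub>1 * ab u\<^sub>2"
        using pairs[OF *] D
        by (cases "ereal (\<beta> u\<^sub>1) + ereal u\<^sub>1 * ab u\<^sub>2") (auto simp: field_simps)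
    qed
    then show ?thesis
      using D by (cases "beta_tilde c \<beta> ab u") (auto simp: field_simps)
  qed
qed

text \<open>
  In \<open>ereal\<close>, \<open>0 * \<infinity> = 0\<close>, so for \<open>b = 0\<close> the claim is not trivial when the oscillation is infinite;
  it is obtained by truncating \<open>f\<close>, which does not increase the Dirichlet form.
\<close>

lemma weak_poincare_of_finite_osc:
  assumes M: "prob_space M" and K: "K \<in> M \<rightarrow>\<^sub>M prob_algebra M" and inv: "M \<bind> K = M"
    and u: "0 \<le> u" and b: "0 \<le> b" and f: "f \<in> L02 M"
    and finite: "\<And>f D. f \<in> L02 M \<Longrightarrow> osc_norm M f = ereal D \<Longrightarrow>
      ereal ((L2_norm M f)\<^sup>2) \<le> ereal (u * dirichlet_form M (kernel_op K) f) + b * ereal (D\<^sup>2)"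
  shows "ereal ((L2_norm M f)\<^sup>2) \<le> ereal (u * dirichlet_form M (kernel_op K) f) + b * (osc_norm M f)\<^sup>2"
proof (cases "osc_norm M f")
  case (real D)
  then show ?thesis
    using finite[OF f real] by simp
next
  case MInf
  then show ?thesis
    using osc_norm_nonneg[OF M, of f] by simp
next
  case PInf
  interpret prob_space M by fact
  have sq: "square_integrable M g" if "g \<in> L02 M" for g
    using that by (simp add: L02_iff)
  show ?thesis
  proof (cases "b = 0")
    case False
    then have "b * (osc_norm M f)\<^sup>2 = \<infinity>"
      using b PInf by (cases b) (auto simp: power2_eq_square)
    then show ?thesis
      by (simp only: plus_ereal.simps ereal_less_eq)
  next
    case True
    let ?g = "clamp_centered M f" and ?E = "dirichlet_form M (kernel_op K)"
    \<comment> \<open>Each truncation has finite oscillation, and the resulting bound does not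
      depend on \<open>n\<close>, so it survives the limit.\<close>
    have "(\<integral>x. (?g n x)\<^sup>2 \<partial>M) \<le> u * ?E f" for n
    proof -
      note g = clamp_centered_L02[OF f, of n]
      obtain D where "osc_norm M (?g n) = ereal D"
        using clamp_centered_osc[OF f, of n] osc_norm_nonneg[OF M, of "?g n"]
        by (cases "osc_norm M (?g n)") auto
      from finite[OF g this] have "(\<integral>x. (?g n x)\<^sup>2 \<partial>M) \<le> u * ?E (?g n)"
        using True by (simp add: L2_norm_square)
      also have "\<dots> \<le> u * ?E f"
        using u by (intro mult_left_mono dirichlet_form_contraction[OF M K inv sq[OF f] sq[OF g]]
            clamp_centered_contraction[OF f])
      finally show ?thesis .
    qed
    then have "(\<integral>x. (f x)\<^sup>2 \<partial>M) \<le> u * ?E f"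
      by (intro LIMSEQ_le_const2[OF clamp_centered_tendsto[OF f]]) auto
    then show ?thesis
      using True by (simp add: L2_norm_square)
  qed
qed

theorem proposition24:
  fixes \<pi> :: "'x measure" and MY :: "'y measure" and MZ :: "'z measure"
    and \<pi>t :: "('y \<times> 'z) measure" and \<omega> :: "'z measure" and \<kappa> :: "'z \<Rightarrow> 'y measure"
    and S :: "'x \<Rightarrow> 'x measure"
    and P :: "('x \<Rightarrow> real) \<Rightarrow> 'y \<times> 'z \<Rightarrow> real"
    and Q :: "'y \<times> 'z \<Rightarrow> ('y \<times> 'z) measure"
    and Qz :: "'z \<Rightarrow> 'y \<Rightarrow> 'y measure"
    and c\<^sub>0 :: real and \<alpha> :: "'z \<Rightarrow> real \<Rightarrow> real" and \<beta> :: "real \<Rightarrow> real"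
  assumes pi: "prob_space \<pi>"
    and pit: "prob_space \<pi>t" "sets \<pi>t = sets (MY \<Otimes>\<^sub>M MZ)"
    and varpi: "\<omega> = distr \<pi>t MZ snd"
    and kappa: "\<kappa> \<in> MZ \<rightarrow>\<^sub>M prob_algebra MY"
    and disintegration: "\<And>A. A \<in> sets (MY \<Otimes>\<^sub>M MZ) \<Longrightarrow>
          emeasure \<pi>t A = (\<integral>\<^sup>+ z. \<integral>\<^sup>+ y. indicator A (y, z) \<partial>\<kappa> z \<partial>\<omega>)"
    and singletons: "\<And>y. y \<in> space MY \<Longrightarrow> {y} \<in> sets MY" "\<And>z. z \<in> space MZ \<Longrightarrow> {z} \<in> sets MZ"
    and S: "reversible_kernel \<pi> S"
    and P: "L02_linear \<pi> \<pi>t P"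
    and Q: "reversible_kernel \<pi>t Q"
    and S_eq: "\<And>f. f \<in> L02 \<pi> \<Longrightarrow>
          AE x in \<pi>. kernel_op S f x = L02_adjoint \<pi> \<pi>t P (kernel_op Q (P f)) x"
    and P_norm: "\<And>f. f \<in> L02 \<pi> \<Longrightarrow> L2_norm \<pi>t (P f) \<le> L2_norm \<pi> f"
    and P_osc: "\<And>f. f \<in> L02 \<pi> \<Longrightarrow> osc_norm \<pi>t (P f) \<le> osc_norm \<pi> f"
    and Qz_kernel: "\<And>z. z \<in> space MZ \<Longrightarrow> Qz z \<in> MY \<rightarrow>\<^sub>M prob_algebra MY"
    and Qz_reversible: "AE z in \<omega>. reversible_kernel (\<kappa> z) (Qz z)"
    and Qz_measurable: "\<And>B. B \<in> sets MY \<Longrightarrow>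
          (\<lambda>(y, z). measure (Qz z y) B) \<in> borel_measurable (MY \<Otimes>\<^sub>M MZ)"
    and c0: "0 < c\<^sub>0" "c\<^sub>0 \<le> 1"
    and Q_ge: "AE (y, z) in \<pi>t. \<forall>B\<in>sets MY.
          measure (Q (y, z)) ((B - {y}) \<times> {z}) \<ge> c\<^sub>0 * measure (Qz z y) (B - {y})"
    and alpha_measurable:
          "(\<lambda>(z, u). \<alpha> z u) \<in> borel_measurable (MZ \<Otimes>\<^sub>M restrict_space borel {0<..})"
    and alpha_nonneg: "\<And>z u. z \<in> space MZ \<Longrightarrow> u > 0 \<Longrightarrow> \<alpha> z u \<ge> 0"
    and Qz_poincare: "AE z in \<omega>. \<forall>u>0. \<forall>g\<in>L02 (\<kappa> z).
          ereal ((L2_norm (\<kappa> z) g)\<^sup>2) \<le>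
            ereal (u * dirichlet_form (\<kappa> z) (kernel_op (Qz z)) g)
            + ereal (\<alpha> z u) * (osc_norm (\<kappa> z) g)\<^sup>2"
    and beta_nonneg: "\<And>u. u > 0 \<Longrightarrow> \<beta> u \<ge> 0"
    and beta_antimono: "antimono_on {0<..} \<beta>"
    and beta_lim: "(\<beta> \<longlongrightarrow> 0) at_top"
    and PEEP_poincare: "\<And>f u. f \<in> L02 \<pi> \<Longrightarrow> u > 0 \<Longrightarrow>
          ereal ((L2_norm \<pi> f)\<^sup>2) \<le>
            ereal (u * dirichlet_form \<pi>
              (L02_adjoint \<pi> \<pi>t P \<circ> fiber_lift \<circ> fiber_avg \<kappa> \<circ> P) f)
            + ereal (\<beta> u) * (osc_norm \<pi> f)\<^sup>2"
  shows "(\<forall>f\<in>L02 \<pi>. \<forall>u>0.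
            ereal ((L2_norm \<pi> f)\<^sup>2) \<le>
              ereal (u * dirichlet_form \<pi> (kernel_op S) f)
              + beta_tilde c\<^sub>0 \<beta> (alpha_bar \<omega> \<alpha>) u * (osc_norm \<pi> f)\<^sup>2) \<and>
         (antimono_on {0<..} (alpha_bar \<omega> \<alpha>) \<and> (alpha_bar \<omega> \<alpha> \<longlongrightarrow> 0) at_top \<longrightarrow>
            antimono_on ({0<..} - {1}) (beta_tilde c\<^sub>0 \<beta> (alpha_bar \<omega> \<alpha>)) \<and>
            antimono_on {1..} (beta_tilde c\<^sub>0 \<beta> (alpha_bar \<omega> \<alpha>)) \<and>
            ((\<beta> \<longlongrightarrow> \<beta> c\<^sub>0) (at_left c\<^sub>0) \<longrightarrow>
               antimono_on {0<..} (beta_tilde c\<^sub>0 \<beta> (alpha_bar \<omega> \<alpha>))) \<and>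
            (beta_tilde c\<^sub>0 \<beta> (alpha_bar \<omega> \<alpha>) \<longlongrightarrow> 0) at_top)"
proof -
  interpret disintegrated_measure MY MZ \<pi>t \<omega> \<kappa>
    by (rule disintegrated_measure.intro[OF pit varpi kappa disintegration])
  interpret beta_rate c\<^sub>0 \<beta> "alpha_bar \<omega> \<alpha>"
    using c0 beta_nonneg by unfold_locales (auto simp: alpha_bar_def)
  have S': "S \<in> \<pi> \<rightarrow>\<^sub>M prob_algebra \<pi>" "\<pi> \<bind> S = \<pi>"
    and Q': "Q \<in> \<pi>t \<rightarrow>\<^sub>M prob_algebra \<pi>t" "\<pi>t \<bind> Q = \<pi>t"
    using S Q by (auto simp: reversible_kernel_def)
  let ?bt = "beta_tilde c\<^sub>0 \<beta> (alpha_bar \<omega> \<alpha>)"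
  let ?E = "dirichlet_form \<pi> (kernel_op S)"
  have adj: "L02_linear \<pi>t \<pi> (L02_adjoint \<pi> \<pi>t P)"
    "f \<in> L02 \<pi> \<Longrightarrow> h \<in> L02 \<pi>t \<Longrightarrow>
      L2_inner \<pi>t (P f) h = L2_inner \<pi> f (L02_adjoint \<pi> \<pi>t P h)" for f h
    by (rule L02_adjoint[OF pi pit(1) P P_norm]; assumption)+
  have "ereal ((L2_norm \<pi> f)\<^sup>2) \<le> ereal (u * ?E f) + ?bt u * ereal (D\<^sup>2)"
    if f: "f \<in> L02 \<pi>" and osc: "osc_norm \<pi> f = ereal D" and u: "0 < u" for f D u
  proof -
    define h where "h = P f"
    \<comment> \<open>In these four numbers the Dirichlet forms of \<open>S\<close>, of
      \<open>Q\<close> at \<open>h\<close> and of the averaging operator are \<open>X - q\<close>,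
      \<open>Y - q\<close> and \<open>X - W\<close>; what remains is arithmetic.\<close>
    define X Y W q where "X = (L2_norm \<pi> f)\<^sup>2" and "Y = (L2_norm \<pi>t h)\<^sup>2"
      and "W = (L2_norm \<omega> (fiber_avg \<kappa> h))\<^sup>2" and "q = L2_inner \<pi>t h (kernel_op Q h)"
    have h: "h \<in> L02 \<pi>t"
      unfolding h_def by (rule L02_linearD(1)[OF P f])
    have sq_f: "square_integrable \<pi> f" and sq_h: "square_integrable \<pi>t h"
      and sq_avg: "square_integrable \<omega> (fiber_avg \<kappa> h)"
      using f h fiber_avg_L02[OF h] by (simp_all add: L02_iff)
    have Qh: "kernel_op Q h \<in> L02 \<pi>t"
      using kernel_op_L02[OF pit(1) Q'(1), of h] h Q'(2) by argo
    have Sf: "kernel_op S f \<in> L02 \<pi>"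
      using kernel_op_L02[OF pi S'(1), of f] f S'(2) by argo
    have AQh: "L02_adjoint \<pi> \<pi>t P (kernel_op Q h) \<in> L02 \<pi>"
      by (rule L02_linearD(1)[OF adj(1) Qh])
    have "L2_inner \<pi> f (kernel_op S f) = L2_inner \<pi> f (L02_adjoint \<pi> \<pi>t P (kernel_op Q h))"
      using Sf AQh sq_f S_eq[OF f] by (intro L2_inner_cong_AE) (auto simp: L02_iff h_def)
    also have "\<dots> = q"
      unfolding q_def h_def by (rule adj(2)[OF f Qh[unfolded h_def], symmetric])
    finally have E_S: "?E f = X - q"
      by (simp add: dirichlet_form_def X_def)
    have E_Q: "dirichlet_form \<pi>t (kernel_op Q) h = Y - q"
      by (simp add: dirichlet_form_def Y_def q_def)
    have "L2_inner \<pi> f (L02_adjoint \<pi> \<pi>t P (fiber_lift (fiber_avg \<kappa> h)))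
        = L2_inner \<pi>t h (fiber_lift (fiber_avg \<kappa> h))"
      unfolding h_def
      by (rule adj(2)[OF f fiber_lift_L02[OF fiber_avg_L02[OF h[unfolded h_def]]], symmetric])
    also have "\<dots> = W"
      unfolding L2_inner_fiber_lift[OF sq_h sq_avg]
      unfolding W_def L2_norm_square by (simp add: L2_inner_def power2_eq_square)
    finally have E_P: "dirichlet_form \<pi> (L02_adjoint \<pi> \<pi>t P \<circ> fiber_lift \<circ> fiber_avg \<kappa> \<circ> P) f = X - W"
      by (simp add: dirichlet_form_def X_def h_def)
    have YX: "Y \<le> X"
      unfolding X_def Y_def h_def using P_norm[OF f]
      by (intro power_mono) (auto simp: L2_norm_def L2_inner_def)
    have E_nonneg: "0 \<le> ?E f"
      by (rule dirichlet_form_eq_double_integral(1)[OF pi S' sq_f])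
    obtain a where "AE x in \<pi>. a \<le> f x \<and> f x \<le> a + D"
      using osc_norm_leD[OF pi] osc by force
    then have var: "X \<le> D\<^sup>2 / 4"
      using prob_space.popoviciu[OF pi f] by (simp add: X_def L2_norm_square)
    have "osc_norm \<pi>t h \<le> ereal D"
      using P_osc[OF f] osc by (simp add: h_def)
    then obtain m where m: "AE p in \<pi>t. m \<le> h p \<and> h p \<le> m + D"
      using osc_norm_leD[OF pit(1)] by blast
    have "ereal X \<le> ereal (u * ?E f) + (ereal (\<beta> u\<^sub>1) + ereal u\<^sub>1 * alpha_bar \<omega> \<alpha> u\<^sub>2) * ereal (D\<^sup>2)"
      if u12: "u\<^sub>1 * u\<^sub>2 = c\<^sub>0 * u" and u1: "0 < u\<^sub>1" and u2: "1 < u\<^sub>2" for u\<^sub>1 u\<^sub>2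
    proof -
      have u2_pos: "0 < u\<^sub>2"
        using u2 by simp
      define A where "A = (\<integral>\<^sup>+z. ennreal (\<alpha> z u\<^sub>2) \<partial>\<omega>)"
      have "(\<lambda>z. \<alpha> z u\<^sub>2) \<in> borel_measurable MZ"
        using measurable_compose[OF _ alpha_measurable, of "\<lambda>z. (z, u\<^sub>2)" MZ] u2_pos by simp
      moreover have "AE z in \<omega>. \<forall>g\<in>L02 (\<kappa> z). ereal ((L2_norm (\<kappa> z) g)\<^sup>2) \<le>
            ereal (u\<^sub>2 * dirichlet_form (\<kappa> z) (kernel_op (Qz z)) g)
            + ereal (\<alpha> z u\<^sub>2) * (osc_norm (\<kappa> z) g)\<^sup>2"
        using Qz_poincare u2_pos by (auto elim!: eventually_mono)
      ultimately have fp: "ennreal (Y - W) \<le> ennreal (u\<^sub>2 / c\<^sub>0 * (Y - q)) + A * ennreal (D\<^sup>2)"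
        using fiber_poincare[OF Q' singletons Qz_kernel Qz_reversible Qz_measurable c0(1) Q_ge
            u2_pos _ alpha_nonneg _ sq_h m] u2_pos
        unfolding E_Q by (simp add: Y_def W_def A_def L2_norm_square)
      show ?thesis
      proof (cases A)
        case (real r)
        have EQ_nonneg: "0 \<le> Y - q"
          unfolding E_Q[symmetric] by (rule dirichlet_form_eq_double_integral(1)[OF pit(1) Q' sq_h])
        have k: "1 \<le> u\<^sub>2 / c\<^sub>0"
          using c0 u2 by simp
        have nonneg: "0 \<le> u\<^sub>2 / c\<^sub>0 * (Y - q)" "0 \<le> r * D\<^sup>2"
          using mult_nonneg_nonneg[OF order_trans[OF zero_le_one k] EQ_nonneg] real(1) by simp_all
        have "A * ennreal (D\<^sup>2) = ennreal (r * D\<^sup>2)"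
          using real by (simp add: ennreal_mult)
        then have "ennreal (Y - W) \<le> ennreal (u\<^sub>2 / c\<^sub>0 * (Y - q) + r * D\<^sup>2)"
          using fp ennreal_plus[OF nonneg] by simp
        then have YW: "Y - W \<le> u\<^sub>2 / c\<^sub>0 * (Y - q) + r * D\<^sup>2"
          using nonneg by (subst (asm) ennreal_le_iff) auto
        have "1 * (X - Y) \<le> u\<^sub>2 / c\<^sub>0 * (X - Y)"
          using k YX by (intro mult_right_mono) auto
        with YW have XW: "X - W \<le> u\<^sub>2 / c\<^sub>0 * (X - q) + r * D\<^sup>2"
          by (simp add: right_diff_distrib)
        \<comment> \<open>Now the constraint on the pair makes the factor of the Dirichlet form of
          \<open>S\<close> equal to \<open>u\<close>.\<close>
        have "X \<le> u\<^sub>1 * (X - W) + \<beta> u\<^sub>1 * D\<^sup>2"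
          using PEEP_poincare[OF f u1] unfolding E_P osc X_def[symmetric] by simp
        also have "\<dots> \<le> u\<^sub>1 * (u\<^sub>2 / c\<^sub>0 * (X - q) + r * D\<^sup>2) + \<beta> u\<^sub>1 * D\<^sup>2"
          using XW u1 by (intro add_right_mono mult_left_mono) auto
        also have "\<dots> = (u\<^sub>1 * u\<^sub>2) / c\<^sub>0 * (X - q) + (\<beta> u\<^sub>1 + u\<^sub>1 * r) * D\<^sup>2"
          by (simp add: algebra_simps)
        also have "\<dots> = u * (X - q) + (\<beta> u\<^sub>1 + u\<^sub>1 * r) * D\<^sup>2"
          using c0(1) by (simp add: u12)
        finally show ?thesis
          using real by (simp add: E_S alpha_bar_def A_def[symmetric])
      next
        \<comment> \<open>The right side is infinite unless D = 0, where 0 * \<infinity> = 0 and the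
          variance bound has to be used.\<close>
        case top
        then have ab: "alpha_bar \<omega> \<alpha> u\<^sub>2 = \<infinity>"
          by (simp add: alpha_bar_def A_def[symmetric])
        show ?thesis
        proof (cases "D = 0")
          case True
          have "0 \<le> u * ?E f"
            using u E_nonneg by simp
          then show ?thesis
            using True var by (simp add: zero_ereal_def[symmetric])
        next
          case False
          then show ?thesis
            using u1 by (simp add: ab)
        qed
      qed
    qed
    then show ?thesis
      using weak_poincare_beta_tilde[OF u E_nonneg var] by (simp add: X_def)
  qed
  then have "ereal ((L2_norm \<pi> f)\<^sup>2) \<le> ereal (u * ?E f) + ?bt u * (osc_norm \<pi> f)\<^sup>2"
    if "f \<in> L02 \<pi>" "0 < u" for f u
    using that by (intro weak_poincare_of_finite_osc[OF pi S' _ beta_tilde_nonneg]) auto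
  then show ?thesis
    using beta_tilde_antimono_except_1 beta_tilde_antimono_ge_1 beta_tilde_antimono
      beta_tilde_tendsto_0[OF _ beta_lim] by blast
qed

end
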